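(* The lattice system $\frac{du}{dt}=Fu$ in $\ell^2$ has a unique global attractor $\mathcal A$, and it can be expressed as $$\mathcal A=\bigcap_{T>0}\overline{\bigcup_{t\ge T}u(t,B_{r^*})},\qquad r^*=1+\frac{\|f\|}{\lambda-\lambda^*}.$$
   Context: $\ell^2$ is the Hilbert space of real square-summable sequences $u=(u_i)_{i\in\mathbb Z}$ with norm $\|u\|=(\sum_i u_i^2)^{1/2}$; $B_r=\{u\in\ell^2:\|u\|\le r\}$. Parameters: $\alpha,\beta,\nu,\lambda>0$, $\gamma\in(0,1)$, and $f\in\ell^2$. Operators: $(\Lambda u)_i=-u_{i-1}+2u_i-u_{i+1}$, $(D^-u)_i=u_{i-1}-u_i$. Products of sequences are componentwise. The vector field is $Fu=\nu\Lambda u-\alpha uD^-u+\beta u(1-u)(u-\gamma)-\lambda u+f$. Let $\lambda^*=4\nu+\frac{(2\alpha+\beta+\beta\gamma)^2}{4\beta}-\beta\gamma$; standing assumption: $\lambda>\lambda^*$. For $u_0\in\ell^2$, $u(t,u_0)$, $t\ge0$, denotes the unique solution in $C([0,\infty),\ell^2)$ of $\frac{du}{dt}=Fu$ with $u(0)=u_0$, and $u(t,B)=\{u(t,u_0):u_0\in B\}$. The Hausdorff semi-distance is $d_{\ell^2}(A,B)=\sup_{a\in A}\inf_{b\in B}\|a-b\|$. A global attractor is a compact set $\mathcal A\subset\ell^2$ with $u(t,\mathcal A)=\mathcal A$ for all $t\ge0$ and $\lim_{t\to+\infty}d_{\ell^2}(u(t,B_r),\mathcal A)=0$ for all $r>0$.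 *)

theory Defs
  imports "HOL-Analysis.Analysis"
begin

section \<open>The Hilbert space of real square-summable bi-infinite sequences\<close>

definition square_summable :: "(int \<Rightarrow> real) \<Rightarrow> bool" where
  "square_summable u \<longleftrightarrow> (\<lambda>i. (u i)\<^sup>2) summable_on UNIV"

lemma square_summable_zero: "square_summable (\<lambda>i. 0)"
  by (simp add: square_summable_def)

lemma square_summable_scale:
  assumes "square_summable u"
  shows "square_summable (\<lambda>i. c * u i)"
  using assms unfolding square_summable_def power_mult_distrib
  by (rule summable_on_cmult_right)

lemma square_summable_add:
  assumes "square_summable u" "square_summable v"
  shows "square_summable (\<lambda>i. u i + v i)"
proof -
  have "(\<lambda>i. 2 * (u i)\<^sup>2 + 2 * (v i)\<^sup>2) summable_on UNIV"
    using assms unfolding square_summable_def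
    by (intro summable_on_add summable_on_cmult_right)
  moreover have "(u i + v i)\<^sup>2 \<le> 2 * (u i)\<^sup>2 + 2 * (v i)\<^sup>2" for i
    using sum_squares_ge_zero[of "u i - v i" 0] by (simp add: power2_eq_square algebra_simps)
  ultimately show ?thesis
    unfolding square_summable_def by (rule summable_on_comparison_test) auto
qed

lemma square_summable_uminus: "square_summable u \<Longrightarrow> square_summable (\<lambda>i. - u i)"
  using square_summable_scale[of u "-1"] by simp

lemma square_summable_diff:
  "square_summable u \<Longrightarrow> square_summable v \<Longrightarrow> square_summable (\<lambda>i. u i - v i)"
  using square_summable_add[of u "\<lambda>i. - v i"] square_summable_uminus[of v] by simp

lemma square_summable_shift:
  assumes "square_summable u"
  shows "square_summable (\<lambda>i. u (i + k))"
proof -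
  have "bij_betw (\<lambda>i. i + k) UNIV (UNIV :: int set)"
    by (rule bij_betw_byWitness[where f' = "\<lambda>i. i - k"]) auto
  from summable_on_reindex_bij_betw[OF this, of "\<lambda>i. (u i)\<^sup>2"] assms show ?thesis
    by (simp add: square_summable_def)
qed

lemma square_summable_component_le:
  assumes "square_summable u"
  shows "(u i)\<^sup>2 \<le> (\<Sum>\<^sub>\<infinity>j. (u j)\<^sup>2)"
  using finite_sum_le_infsum[of "\<lambda>j. (u j)\<^sup>2" UNIV "{i}"] assms
  by (simp add: square_summable_def)

lemma square_summable_mult:
  assumes "square_summable u" "square_summable v"
  shows "square_summable (\<lambda>i. u i * v i)"
proof -
  have "(\<lambda>i. (\<Sum>\<^sub>\<infinity>j. (u j)\<^sup>2) * (v i)\<^sup>2) summable_on UNIV"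
    using assms unfolding square_summable_def by (intro summable_on_cmult_right)
  moreover have "(u i * v i)\<^sup>2 \<le> (\<Sum>\<^sub>\<infinity>j. (u j)\<^sup>2) * (v i)\<^sup>2" for i
    using square_summable_component_le[OF assms(1), of i]
    by (simp add: power_mult_distrib mult_right_mono)
  ultimately show ?thesis
    unfolding square_summable_def by (rule summable_on_comparison_test) auto
qed

lemma square_summable_prod:
  assumes "square_summable u" "square_summable v"
  shows "(\<lambda>i. u i * v i) summable_on UNIV"
proof -
  have "(\<lambda>i. (1/4) * (u i + v i)\<^sup>2 + (-1/4) * (u i - v i)\<^sup>2) summable_on UNIV"
    using square_summable_add[OF assms] square_summable_diff[OF assms]
    unfolding square_summable_def by (intro summable_on_add summable_on_cmult_right)
  moreover have "(1/4) * (u i + v i)\<^sup>2 + (-1/4) * (u i - v i)\<^sup>2 = u i * v i" for i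
    by (simp add: power2_eq_square algebra_simps)
  ultimately show ?thesis by simp
qed

typedef ell2 = "{u :: int \<Rightarrow> real. square_summable u}"
  morphisms component Abs_ell2
  using square_summable_zero by blast

setup_lifting type_definition_ell2

lemma square_summable_component: "square_summable (component u)"
  using component by blast

lemma ell2_eqI: "(\<And>i. component u i = component v i) \<Longrightarrow> u = v"
  by (simp add: component_inject[symmetric] fun_eq_iff)

instantiation ell2 :: real_vector
begin

lift_definition zero_ell2 :: ell2 is "\<lambda>i. 0" by (rule square_summable_zero)
lift_definition plus_ell2 :: "ell2 \<Rightarrow> ell2 \<Rightarrow> ell2" is "\<lambda>u v i. u i + v i"
  by (rule square_summable_add)
lift_definition minus_ell2 :: "ell2 \<Rightarrow> ell2 \<Rightarrow> ell2" is "\<lambda>u v i. u i - v i"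
  by (rule square_summable_diff)
lift_definition uminus_ell2 :: "ell2 \<Rightarrow> ell2" is "\<lambda>u i. - u i"
  by (rule square_summable_uminus)
lift_definition scaleR_ell2 :: "real \<Rightarrow> ell2 \<Rightarrow> ell2" is "\<lambda>c u i. c * u i"
  by (rule square_summable_scale)

instance
  by standard (transfer; simp add: algebra_simps fun_eq_iff)+

end

instantiation ell2 :: real_inner
begin

lift_definition inner_ell2 :: "ell2 \<Rightarrow> ell2 \<Rightarrow> real" is "\<lambda>u v. \<Sum>\<^sub>\<infinity>i. u i * v i" .
lift_definition norm_ell2 :: "ell2 \<Rightarrow> real" is "\<lambda>u. sqrt (\<Sum>\<^sub>\<infinity>i. (u i)\<^sup>2)" .

definition sgn_ell2 :: "ell2 \<Rightarrow> ell2" where "sgn_ell2 u = u /\<^sub>R norm u"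
definition dist_ell2 :: "ell2 \<Rightarrow> ell2 \<Rightarrow> real" where "dist_ell2 u v = norm (u - v)"
definition uniformity_ell2 :: "(ell2 \<times> ell2) filter" where
  "uniformity_ell2 = (INF e\<in>{0<..}. principal {(u, v). dist u v < e})"
definition open_ell2 :: "ell2 set \<Rightarrow> bool" where
  "open_ell2 U \<longleftrightarrow> (\<forall>u\<in>U. \<forall>\<^sub>F (u', v) in uniformity. u' = u \<longrightarrow> v \<in> U)"

instance
proof
  fix u v w :: ell2 and c :: real
  show "dist u v = norm (u - v)" by (rule dist_ell2_def)
  show "sgn u = u /\<^sub>R norm u" by (rule sgn_ell2_def)
  show "uniformity = (INF e\<in>{0<..}. principal {(u :: ell2, v). dist u v < e})"
    by (rule uniformity_ell2_def)
  show "open U \<longleftrightarrow> (\<forall>u\<in>U. \<forall>\<^sub>F (u', v) in uniformity. u' = u \<longrightarrow> v \<in> U)" for U :: "ell2 set"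
    by (rule open_ell2_def)
  show "u \<bullet> v = v \<bullet> u" by transfer (simp add: mult.commute)
  show "(u + v) \<bullet> w = u \<bullet> w + v \<bullet> w"
    by transfer (simp add: distrib_right infsum_add square_summable_prod)
  show "(c *\<^sub>R u) \<bullet> v = c * (u \<bullet> v)"
    by transfer (simp add: mult.assoc infsum_cmult_right')
  show "0 \<le> u \<bullet> u" by transfer (simp add: infsum_nonneg)
  show "(u \<bullet> u = 0) = (u = 0)"
  proof
    assume "u \<bullet> u = 0"
    then show "u = 0"
    proof transfer
      fix u :: "int \<Rightarrow> real"
      assume u: "square_summable u" and "(\<Sum>\<^sub>\<infinity>i. u i * u i) = 0"
      then have "(u i)\<^sup>2 \<le> 0" for i
        using square_summable_component_le[OF u, of i] by (simp add: power2_eq_square)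
      then show "u = (\<lambda>i. 0)" by (simp add: fun_eq_iff)
    qed
  qed (transfer, simp)
  show "norm u = sqrt (u \<bullet> u)" by transfer (simp add: power2_eq_square)
qed

end

lemma norm_ell2_squared: "(norm u)\<^sup>2 = (\<Sum>\<^sub>\<infinity>i. (component u i)\<^sup>2)"
  by transfer (simp add: infsum_nonneg)

lemma abs_component_le_norm: "\<bar>component u i\<bar> \<le> norm u"
proof -
  have "(component u i)\<^sup>2 \<le> (norm u)\<^sup>2"
    using square_summable_component_le[OF square_summable_component] by (simp add: norm_ell2_squared)
  then show ?thesis using power2_le_iff_abs_le[OF norm_ge_zero] by blast
qed

lemma sum_component_le_norm:
  "finite S \<Longrightarrow> (\<Sum>i\<in>S. (component u i)\<^sup>2) \<le> (norm u)\<^sup>2"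
  unfolding norm_ell2_squared using square_summable_component[of u]
  by (intro finite_sum_le_infsum) (auto simp: square_summable_def)

instance ell2 :: complete_space
proof
  fix X :: "nat \<Rightarrow> ell2"
  assume X: "Cauchy X"
  have "Cauchy (\<lambda>n. component (X n) i)" for i
  proof (rule metric_CauchyI)
    fix e :: real assume "0 < e"
    then obtain N where N: "\<forall>m\<ge>N. \<forall>n\<ge>N. dist (X m) (X n) < e"
      using X metric_CauchyD by blast
    have le: "dist (component (X m) i) (component (X n) i) \<le> dist (X m) (X n)" for m n
      using abs_component_le_norm[of "X m - X n" i]
      by (simp add: dist_norm dist_real_def minus_ell2.rep_eq)
    have "dist (component (X m) i) (component (X n) i) < e" if "m \<ge> N" "n \<ge> N" for m n
      using N that by (intro le_less_trans[OF le]) simp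
    then show "\<exists>N. \<forall>m\<ge>N. \<forall>n\<ge>N. dist (component (X m) i) (component (X n) i) < e"
      by (intro exI[of _ N] allI impI)
  qed
  then have conv: "convergent (\<lambda>n. component (X n) i)" for i
    by (rule real_Cauchy_convergent)
  define L where "L i = lim (\<lambda>n. component (X n) i)" for i
  have L: "(\<lambda>n. component (X n) i) \<longlonglongrightarrow> L i" for i
    using conv[of i] by (simp add: L_def convergent_LIMSEQ_iff)
  have bound: "\<exists>N. \<forall>n\<ge>N. \<forall>S. finite S \<longrightarrow> (\<Sum>i\<in>S. (component (X n) i - L i)\<^sup>2) \<le> e\<^sup>2"
    if e: "0 < e" for e :: real
  proof -
    obtain N where N: "\<forall>m\<ge>N. \<forall>n\<ge>N. dist (X m) (X n) < e"
      using X metric_CauchyD e by blast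
    have "(\<Sum>i\<in>S. (component (X n) i - L i)\<^sup>2) \<le> e\<^sup>2" if n: "n \<ge> N" and S: "finite S" for n S
    proof (rule tendsto_upperbound)
      show "(\<lambda>m. \<Sum>i\<in>S. (component (X n) i - component (X m) i)\<^sup>2)
              \<longlonglongrightarrow> (\<Sum>i\<in>S. (component (X n) i - L i)\<^sup>2)"
        by (intro tendsto_intros L)
      have "(\<Sum>i\<in>S. (component (X n) i - component (X m) i)\<^sup>2) \<le> e\<^sup>2" if "m \<ge> N" for m
      proof -
        have "(\<Sum>i\<in>S. (component (X n) i - component (X m) i)\<^sup>2) \<le> (norm (X n - X m))\<^sup>2"
          using sum_component_le_norm[OF S, of "X n - X m"] by (simp add: minus_ell2.rep_eq)
        also have "\<dots> \<le> e\<^sup>2"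
          using N n that by (intro power_mono) (auto simp: dist_norm intro: less_imp_le)
        finally show ?thesis .
      qed
      then show "\<forall>\<^sub>F m in sequentially. (\<Sum>i\<in>S. (component (X n) i - component (X m) i)\<^sup>2) \<le> e\<^sup>2"
        by (auto simp: eventually_sequentially)
    qed simp
    then show ?thesis by blast
  qed
  have summable: "square_summable (\<lambda>i. component (X n) i - L i)"
    if "\<forall>S. finite S \<longrightarrow> (\<Sum>i\<in>S. (component (X n) i - L i)\<^sup>2) \<le> e" for n e
    unfolding square_summable_def
    by (rule nonneg_bdd_above_summable_on) (use that in \<open>auto intro!: bdd_aboveI2\<close>)
  obtain N1 where "\<forall>n\<ge>N1. \<forall>S. finite S \<longrightarrow> (\<Sum>i\<in>S. (component (X n) i - L i)\<^sup>2) \<le> 1\<^sup>2"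
    using bound[of 1] by auto
  then have "square_summable (\<lambda>i. component (X N1) i - L i)"
    using summable by blast
  from square_summable_diff[OF square_summable_component[of "X N1"] this]
  have sL: "square_summable L" by simp
  define l where "l = Abs_ell2 L"
  have l: "component l = L"
    unfolding l_def using sL by (simp add: Abs_ell2_inverse)
  have "X \<longlonglongrightarrow> l"
  proof (rule metric_LIMSEQ_I)
    fix e :: real assume e: "0 < e"
    obtain N where N: "\<forall>n\<ge>N. \<forall>S. finite S \<longrightarrow> (\<Sum>i\<in>S. (component (X n) i - L i)\<^sup>2) \<le> (e / 2)\<^sup>2"
      using bound[of "e / 2"] e by auto
    have "dist (X n) l < e" if "n \<ge> N" for n
    proof -
      have "(norm (X n - l))\<^sup>2 \<le> (e / 2)\<^sup>2"
        unfolding norm_ell2_squared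
      proof (rule infsum_le_finite_sums)
        show "(\<lambda>i. (component (X n - l) i)\<^sup>2) summable_on UNIV"
          using square_summable_component[of "X n - l"] by (simp add: square_summable_def)
      qed (use N that l in \<open>simp add: minus_ell2.rep_eq\<close>)
      then have "norm (X n - l) \<le> e / 2" using e by (simp add: power2_le_iff_abs_le)
      then show ?thesis using e by (simp add: dist_norm)
    qed
    then show "\<exists>N. \<forall>n\<ge>N. dist (X n) l < e" by blast
  qed
  then show "convergent X" by (rule convergentI)
qed

section \<open>The lattice system\<close>

definition lattice_Lambda :: "(int \<Rightarrow> real) \<Rightarrow> int \<Rightarrow> real" where
  "lattice_Lambda u i = - u (i - 1) + 2 * u i - u (i + 1)"

definition lattice_Dminus :: "(int \<Rightarrow> real) \<Rightarrow> int \<Rightarrow> real" where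
  "lattice_Dminus u i = u (i - 1) - u i"

lemma square_summable_lattice_Lambda:
  assumes "square_summable u"
  shows "square_summable (lattice_Lambda u)"
proof -
  have "square_summable (\<lambda>i. - u (i + (-1)) + 2 * u i - u (i + 1))"
    using assms
    by (intro square_summable_diff square_summable_add square_summable_uminus
        square_summable_shift square_summable_scale)
  then show ?thesis by (simp add: lattice_Lambda_def[abs_def])
qed

lemma square_summable_lattice_Dminus:
  assumes "square_summable u"
  shows "square_summable (lattice_Dminus u)"
  using square_summable_diff[OF square_summable_shift[OF assms, of "-1"] assms]
  by (simp add: lattice_Dminus_def[abs_def])

text \<open>The constant sequence \<open>1\<close> is not square summable, so the cubic reaction term is written
  componentwise; only the whole field is an operator on the sequence space.\<close>

lift_definition lattice_field ::
  "real \<Rightarrow> real \<Rightarrow> real \<Rightarrow> real \<Rightarrow> real \<Rightarrow> ell2 \<Rightarrow> ell2 \<Rightarrow> ell2"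
  is "\<lambda>\<nu> \<alpha> \<beta> \<gamma> lam f u i.
        \<nu> * lattice_Lambda u i - \<alpha> * (u i * lattice_Dminus u i)
        + \<beta> * (u i * (1 - u i) * (u i - \<gamma>)) - lam * u i + f i"
proof -
  fix \<nu> \<alpha> \<beta> \<gamma> lam :: real and f u :: "int \<Rightarrow> real"
  assume f: "square_summable f" and u: "square_summable u"
  have "square_summable (\<lambda>i. (1 + \<gamma>) * (u i * u i) - u i * (u i * u i) - \<gamma> * u i)"
    using u by (intro square_summable_diff square_summable_scale square_summable_mult)
  moreover have "(1 + \<gamma>) * (u i * u i) - u i * (u i * u i) - \<gamma> * u i
      = u i * (1 - u i) * (u i - \<gamma>)" for i
    by (simp add: algebra_simps)
  ultimately have reaction: "square_summable (\<lambda>i. \<beta> * (u i * (1 - u i) * (u i - \<gamma>)))"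
    by (intro square_summable_scale) simp
  have convection: "square_summable (\<lambda>i. \<alpha> * (u i * lattice_Dminus u i))"
    using u by (intro square_summable_scale square_summable_mult square_summable_lattice_Dminus)
  have diffusion: "square_summable (\<lambda>i. \<nu> * lattice_Lambda u i)"
    using u by (intro square_summable_scale square_summable_lattice_Lambda)
  show "square_summable (\<lambda>i. \<nu> * lattice_Lambda u i - \<alpha> * (u i * lattice_Dminus u i)
        + \<beta> * (u i * (1 - u i) * (u i - \<gamma>)) - lam * u i + f i)"
    by (rule square_summable_add[OF square_summable_diff[OF square_summable_add[OF
          square_summable_diff[OF diffusion convection] reaction] square_summable_scale[OF u]] f])
qed

definition lambda_star :: "real \<Rightarrow> real \<Rightarrow> real \<Rightarrow> real \<Rightarrow> real" where
  "lambda_star \<nu> \<alpha> \<beta> \<gamma> = 4 * \<nu> + (2 * \<alpha> + \<beta> + \<beta> * \<gamma>)\<^sup>2 / (4 * \<beta>) - \<beta> * \<gamma>"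

section \<open>Solutions and global attractors\<close>

definition solves_ivp ::
  "('a::real_normed_vector \<Rightarrow> 'a) \<Rightarrow> 'a \<Rightarrow> (real \<Rightarrow> 'a) \<Rightarrow> bool" where
  "solves_ivp F u0 u \<longleftrightarrow>
     continuous_on {0..} u \<and> u 0 = u0 \<and>
     (\<forall>t\<ge>0. (u has_vector_derivative F (u t)) (at t within {0..}))"

text \<open>The value at time \<open>t\<close> of the solution starting at \<open>u0\<close>. The description ranges over
  values rather than functions, since \<^const>\<open>solves_ivp\<close> does not constrain a function at
  negative times. For \<open>t \<ge> 0\<close> it is meaningful exactly because the initial value problem is
  uniquely solvable.\<close>

definition solution ::
  "('a::real_normed_vector \<Rightarrow> 'a) \<Rightarrow> real \<Rightarrow> 'a \<Rightarrow> 'a" where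
  "solution F t u0 = (THE x. \<exists>u. solves_ivp F u0 u \<and> u t = x)"

text \<open>Valued in \<^typ>\<open>ennreal\<close>, so that the distance from a nonempty set to the empty set and
  from an unbounded set to a bounded one is \<open>\<infinity>\<close>.\<close>

definition hausdorff_semidist :: "'a::real_normed_vector set \<Rightarrow> 'a set \<Rightarrow> ennreal" where
  "hausdorff_semidist A B = (SUP a\<in>A. INF b\<in>B. ennreal (norm (a - b)))"

definition global_attractor :: "('a::real_normed_vector \<Rightarrow> 'a) \<Rightarrow> 'a set \<Rightarrow> bool" where
  "global_attractor F A \<longleftrightarrow>
     compact A \<and>
     (\<forall>t\<ge>0. solution F t ` A = A) \<and>
     (\<forall>r>0. ((\<lambda>t. hausdorff_semidist (solution F t ` cball 0 r) A) \<longlongrightarrow> 0) at_top)"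

end

theory Submission
  imports Defs
begin

text \<open>Pairing the field with \<open>u\<close> and using Young's inequality for the convection term gives
  \<open>u \<bullet> F u \<le> - \<kappa> * (norm u)\<^sup>2 + norm f * norm u\<close> with \<open>\<kappa> = lam - lambda_star \<nu> \<alpha> \<beta> \<gamma>\<close>, hence global
  solutions and an absorbing ball. The same computation with a slowly varying cutoff inserted
  costs only an error proportional to the slope of the cutoff, so the part of a solution carried by
  large indices becomes uniformly small. Together with componentwise compactness this yields
  asymptotic compactness, and the omega-limit set of the absorbing ball is the attractor. Any two
  attractors attract each other, being bounded and invariant, and therefore coincide.\<close>

section \<open>Differential inequalities and global Picard iteration\<close>

text \<open>The coupling has the energy-producing sign: \<Lambda> is nonnegative with norm 4, so it
  may feed energy at rate \<open>4 * \<nu>\<close>. Convection has no sign and is cubic in the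
  energy balance; only the quartic loss from the reaction term can pay for it. With \<open>a\<close>
  the modulus of a component, the two together contribute at most \<open>a\<^sup>2\<close> times the
  quadratic \<open>(2 * \<alpha> + \<beta> + \<beta> * \<gamma>) * a - \<beta> * a\<^sup>2 - \<beta>
  * \<gamma>\<close>, and the maximum of this quadratic plus \<open>4 * \<nu>\<close> is
  \<open>lambda_star\<close>. In the radius of the absorbing ball, \<open>norm f / \<kappa>\<close>
  is where damping balances forcing, and the added 1 turns asymptotic approach into entry after a
  finite time. Two obstacles shape the proof. The field is Lipschitz only on bounded sets, so
  existence passes through a truncated field. Balls of the sequence space are not compact and the
  flow does not smooth, so compactness can only appear in the limit of large times.\<close>

lemma mvt_halfline:
  fixes y y' :: "real \<Rightarrow> real"
  assumes deriv: "\<And>t. t \<ge> 0 \<Longrightarrow> (y has_real_derivative y' t) (at t within {0..})"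
    and "0 \<le> s" "s < t"
  shows "\<exists>\<xi>\<in>{s<..<t}. y t - y s = y' \<xi> * (t - s)"
proof -
  have "(y has_derivative (\<lambda>h. y' x * h)) (at x within {s..t})" if "s \<le> x" for x
    using deriv[of x] that \<open>0 \<le> s\<close>
    by (auto simp: has_field_derivative_def intro!: has_derivative_subset[where s = "{0..}" and t = "{s..t}"])
  from mvt_simple[OF \<open>s < t\<close> this] show ?thesis by simp
qed

lemma nonincreasing_halfline:
  fixes y y' :: "real \<Rightarrow> real"
  assumes deriv: "\<And>t. t \<ge> 0 \<Longrightarrow> (y has_real_derivative y' t) (at t within {0..})"
    and "\<And>t. t \<ge> 0 \<Longrightarrow> y' t \<le> 0" and "t \<ge> 0"
  shows "y t \<le> y 0"
proof (cases "t = 0")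
  case False
  then obtain \<xi> where "\<xi> \<in> {0<..<t}" "y t - y 0 = y' \<xi> * (t - 0)"
    using mvt_halfline[OF deriv, of 0 t] assms(3) by auto
  with assms(2)[of \<xi>] assms(3) show ?thesis
    by (smt (verit, best) greaterThanLessThan_iff mult_nonpos_nonneg)
qed simp

text \<open>Shifting \<open>y\<close> by \<open>b / c\<close> makes the inequality homogeneous, and
  the integrating factor \<open>exp (- c * t)\<close> then makes it monotone. The sign of
  \<open>c\<close> is left open: negative for energy decay, positive for dependence on initial
  data.\<close>

lemma gronwall_halfline:
  fixes y y' :: "real \<Rightarrow> real"
  assumes deriv: "\<And>t. t \<ge> 0 \<Longrightarrow> (y has_real_derivative y' t) (at t within {0..})"
    and le: "\<And>t. t \<ge> 0 \<Longrightarrow> y' t \<le> c * y t + b" and "c \<noteq> 0" and "t \<ge> 0"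
  shows "y t \<le> exp (c * t) * (y 0 + b / c) - b / c"
proof -
  define z where "z s = exp (- c * s) * (y s + b / c)" for s
  have "z t \<le> z 0"
  proof (rule nonincreasing_halfline[OF _ _ \<open>t \<ge> 0\<close>])
    fix s :: real assume s: "s \<ge> 0"
    show "(z has_real_derivative exp (- c * s) * (y' s - c * y s - b)) (at s within {0..})"
      unfolding z_def using deriv[OF s] \<open>c \<noteq> 0\<close>
      by (auto intro!: derivative_eq_intros simp: field_simps)
    show "exp (- c * s) * (y' s - c * y s - b) \<le> 0"
      using le[OF s] by (simp add: mult_nonneg_nonpos)
  qed
  then have "exp (c * t) * z t \<le> exp (c * t) * (y 0 + b / c)"
    by (simp add: z_def)
  moreover have "exp (c * t) * z t = y t + b / c"
    by (simp add: z_def mult_exp_exp flip: mult.assoc)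
  ultimately show ?thesis by simp
qed

lemma barrier_halfline:
  fixes y y' :: "real \<Rightarrow> real"
  assumes deriv: "\<And>t. t \<ge> 0 \<Longrightarrow> (y has_real_derivative y' t) (at t within {0..})"
    and barrier: "\<And>t. t \<ge> 0 \<Longrightarrow> y t > b \<Longrightarrow> y' t \<le> 0" and "y 0 \<le> b" and "t \<ge> 0"
  shows "y t \<le> b"
proof (rule ccontr)
  assume *: "\<not> y t \<le> b"
  have "continuous_on {0..} y"
    using deriv by (auto simp: continuous_on_eq_continuous_within intro: DERIV_continuous)
  then have "continuous_on {0..t} y" by (rule continuous_on_subset) auto
  \<comment> \<open>Compactness provides the last time \<open>s\<close> at which \<open>y\<close> is
    at most \<open>b\<close>. Beyond it \<open>y\<close> exceeds \<open>b\<close>, hence cannot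
    increase.\<close>
  then have "closed ({0..t} \<inter> y -` {..b})"
    by (intro continuous_closed_preimage) auto
  then have "compact ({0..t} \<inter> y -` {..b})"
    by (metis closed_Int_compact compact_Icc inf.absorb_iff1 inf_le1)
  moreover have "0 \<in> {0..t} \<inter> y -` {..b}" using assms by auto
  ultimately obtain s where "s \<in> {0..t} \<inter> y -` {..b}" "\<forall>r \<in> {0..t} \<inter> y -` {..b}. r \<le> s"
    using compact_attains_sup by blast
  then have s: "s \<in> {0..t}" "y s \<le> b"
    and max: "\<And>r. r \<in> {0..t} \<Longrightarrow> y r \<le> b \<Longrightarrow> r \<le> s"
    by auto
  have "s < t" using s * by (cases "s = t") auto
  then obtain \<xi> where \<xi>: "\<xi> \<in> {s<..<t}" "y t - y s = y' \<xi> * (t - s)"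
    using mvt_halfline[OF deriv, of s t] s by auto
  have "y \<xi> > b" using max[of \<xi>] \<xi> s by fastforce
  then have "y' \<xi> \<le> 0" using barrier[of \<xi>] \<xi> s by auto
  then have "y t \<le> y s" using \<xi> by (smt (verit) greaterThanLessThan_iff mult_nonpos_nonneg)
  with s * show False by simp
qed

lemma integral_has_vector_derivative_halfline:
  fixes g :: "real \<Rightarrow> 'a::banach"
  assumes "continuous_on {0..} g" and "t \<ge> 0"
  shows "((\<lambda>t. integral {0..t} g) has_vector_derivative g t) (at t within {0..})"
proof -
  have "continuous_on {0..t+1} g" using assms(1) by (rule continuous_on_subset) auto
  then have "((\<lambda>t. integral {0..t} g) has_vector_derivative g t) (at t within {0..t+1})"
    using assms(2) by (intro integral_has_vector_derivative) auto
  moreover have "at t within {0..} = at t within {0..t+1}"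
    by (rule at_within_nhd[of t "{..<t+1}"]) auto
  ultimately show ?thesis by simp
qed

text \<open>Integration gains a factor \<open>1 / M\<close> in the exponentially weighted norm; this
  is the contraction factor of the Picard map.\<close>

lemma norm_integral_le_exp:
  fixes g :: "real \<Rightarrow> 'a::banach"
  assumes "continuous_on {0..} g" and "M > 0"
    and le: "\<And>s. s \<ge> 0 \<Longrightarrow> norm (g s) \<le> C * exp (M * s)" and "t \<ge> 0" "C \<ge> 0"
  shows "norm (integral {0..t} g) \<le> C / M * exp (M * t)"
proof -
  have I: "((\<lambda>s. C * exp (M * s)) has_integral (C / M * exp (M * t) - C / M * exp (M * 0))) {0..t}"
    using assms by (intro fundamental_theorem_of_calculus)
      (auto intro!: derivative_eq_intros simp flip: has_real_derivative_iff_has_vector_derivative)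
  have "continuous_on {0..t} g" using assms(1) by (rule continuous_on_subset) auto
  then have "norm (integral {0..t} g) \<le> integral {0..t} (\<lambda>s. C * exp (M * s))"
    using le I by (intro integral_norm_bound_integral integrable_continuous_real) (auto intro!: continuous_intros)
  also have "\<dots> = C / M * exp (M * t) - C / M" using integral_unique[OF I] by simp
  also have "\<dots> \<le> C / M * exp (M * t)" using assms by simp
  finally show ?thesis .
qed

text \<open>Picard iteration on the whole half line: writing \<open>u t = u0 + exp (M * t) *\<^sub>R w t\<close>, the
  integral equation is a contraction for bounded continuous \<open>w\<close> once \<open>M\<close> exceeds the
  Lipschitz constant.\<close>

lemma lipschitz_ivp_solvable:
  fixes G :: "'a::banach \<Rightarrow> 'a"
  assumes "L-lipschitz_on UNIV G"
  shows "\<exists>u. solves_ivp G u0 u"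
proof -
  \<comment> \<open>This gives \<open>L / M \<le> 1/2\<close>, the contraction constant, and keeps
    \<open>M\<close> positive when \<open>L = 0\<close>.\<close>
  define M where "M = 2 * (L + 1)"
  have L: "L \<ge> 0" using assms by (rule lipschitz_on_nonneg)
  then have M: "M > 0" by (simp add: M_def)
  have G: "norm (G x - G y) \<le> L * norm (x - y)" for x y
    using lipschitz_on_normD[OF assms] by simp
  have contG: "continuous_on UNIV G" using assms by (rule lipschitz_on_continuous_on)
  define g where "g w s = G (u0 + exp (M * s) *\<^sub>R apply_bcontfun w s)" for w s
  have cont_g: "continuous_on A (g w)" for A w
    unfolding g_def by (intro continuous_intros continuous_on_compose2[OF contG]) auto
  \<comment> \<open>Bounded continuous functions live on the whole line; \<open>max 0 t\<close>
    extends the iterate continuously by zero to negative times.\<close>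
  define \<Phi> where "\<Phi> w t = exp (- (M * max 0 t)) *\<^sub>R integral {0..max 0 t} (g w)" for w t
  have g_bound: "norm (g w s) \<le> (norm (G u0) + L * norm w) * exp (M * s)" if "s \<ge> 0" for w s
  proof -
    have "norm (g w s) \<le> norm (G u0) + L * norm (exp (M * s) *\<^sub>R apply_bcontfun w s)"
      using G[of "u0 + exp (M * s) *\<^sub>R apply_bcontfun w s" u0]
        norm_triangle_sub[of "g w s" "G u0"] by (simp add: g_def)
    also have "\<dots> \<le> norm (G u0) * exp (M * s) + L * (exp (M * s) * norm w)"
      using L M that norm_bounded[of w s]
      by (intro add_mono mult_left_mono) (auto intro!: mult_left_mono simp: mult_le_cancel_left1)
    finally show ?thesis by (simp add: algebra_simps)
  qed
  have bcont: "\<Phi> w \<in> bcontfun" for w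
  proof (rule bcontfun_normI)
    have "continuous_on {0..} (\<lambda>t. integral {0..t} (g w))"
      using integral_has_vector_derivative_halfline[OF cont_g]
      by (auto simp: continuous_on_eq_continuous_within intro: has_vector_derivative_continuous)
    then show "continuous_on UNIV (\<Phi> w)"
      unfolding \<Phi>_def by (intro continuous_intros) (rule continuous_on_compose2, auto intro!: continuous_intros)
    show "norm (\<Phi> w t) \<le> (norm (G u0) + L * norm w) / M" for t
      using norm_integral_le_exp[OF cont_g M g_bound, of "max 0 t" w] L
      by (simp add: \<Phi>_def exp_minus field_simps)
  qed
  have "\<exists>!w\<in>UNIV. Bcontfun (\<Phi> w) = w"
  proof (rule Banach_fix)
    show "complete (UNIV :: (real \<Rightarrow>\<^sub>C 'a) set)" by (rule complete_UNIV)
    show "dist (Bcontfun (\<Phi> v)) (Bcontfun (\<Phi> w)) \<le> 1/2 * dist v w" for v w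
    proof (rule dist_bound)
      fix t :: real
      define r where "r = max 0 t"
      have r: "r \<ge> 0" by (simp add: r_def)
      have int: "g w integrable_on {0..r}" for w
        by (rule integrable_continuous_real[OF cont_g])
      have "norm (g v s - g w s) \<le> (L * dist v w) * exp (M * s)" for s
      proof -
        have "norm (g v s - g w s) \<le> L * norm (exp (M * s) *\<^sub>R (apply_bcontfun v s - apply_bcontfun w s))"
          using G[of "u0 + exp (M * s) *\<^sub>R apply_bcontfun v s" "u0 + exp (M * s) *\<^sub>R apply_bcontfun w s"]
          by (simp add: g_def algebra_simps)
        also have "\<dots> \<le> L * (exp (M * s) * dist v w)"
          using L dist_bounded[of v s w] by (auto intro!: mult_left_mono simp: dist_norm)
        finally show ?thesis by (simp add: algebra_simps)
      qed
      then have "norm (integral {0..r} (\<lambda>s. g v s - g w s)) \<le> L * dist v w / M * exp (M * r)"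
        using L r M by (intro norm_integral_le_exp) (auto intro!: continuous_intros cont_g)
      also have "\<dots> \<le> 1/2 * dist v w * exp (M * r)"
        using L by (intro mult_right_mono) (auto simp: M_def field_simps)
      also have "integral {0..r} (\<lambda>s. g v s - g w s) = integral {0..r} (g v) - integral {0..r} (g w)"
        by (rule integral_diff[OF int int])
      finally have "exp (- (M * r)) * norm (integral {0..r} (g v) - integral {0..r} (g w))
          \<le> exp (- (M * r)) * (1/2 * dist v w * exp (M * r))"
        by (rule mult_left_mono) simp
      also have "\<dots> = 1/2 * dist v w" by (simp add: exp_minus field_simps)
      also have "exp (- (M * r)) * norm (integral {0..r} (g v) - integral {0..r} (g w)) = norm (\<Phi> v t - \<Phi> w t)"
        by (simp add: \<Phi>_def r_def flip: scaleR_diff_right)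
      finally show "dist (apply_bcontfun (Bcontfun (\<Phi> v)) t) (apply_bcontfun (Bcontfun (\<Phi> w)) t) \<le> 1/2 * dist v w"
        using bcont by (simp add: Bcontfun_inverse dist_norm)
    qed
  qed auto
  then obtain w where w: "Bcontfun (\<Phi> w) = w" by auto
  then have w': "apply_bcontfun w t = \<Phi> w t" for t
    using bcont[of w] by (metis Bcontfun_inverse)
  define u where "u t = u0 + integral {0..t} (g w)" for t
  have gu: "g w t = G (u t)" if "t \<ge> 0" for t
    using that by (simp add: g_def u_def w' \<Phi>_def mult_exp_exp)
  have "(u has_vector_derivative G (u t)) (at t within {0..})" if "t \<ge> 0" for t
  proof -
    have "((\<lambda>t. u0 + integral {0..t} (g w)) has_vector_derivative 0 + g w t) (at t within {0..})"
      by (intro has_vector_derivative_add has_vector_derivative_const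
          integral_has_vector_derivative_halfline[OF cont_g that])
    then show ?thesis by (simp add: gu[OF that, symmetric] flip: u_def)
  qed
  then have "solves_ivp G u0 u"
    unfolding solves_ivp_def continuous_on_eq_continuous_within
    by (auto simp: u_def[of 0] intro: has_vector_derivative_continuous)
  then show ?thesis by blast
qed

section \<open>Dissipative vector fields\<close>

definition radial_retraction :: "real \<Rightarrow> 'a::real_normed_vector \<Rightarrow> 'a" where
  "radial_retraction R u = (R / max R (norm u)) *\<^sub>R u"

lemma radial_retraction_id: "R > 0 \<Longrightarrow> norm u \<le> R \<Longrightarrow> radial_retraction R u = u"
  by (simp add: radial_retraction_def max_absorb1)

lemma norm_radial_retraction_le: "R > 0 \<Longrightarrow> norm (radial_retraction R u) \<le> R"
  by (simp add: radial_retraction_def divide_simps max_def)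

text \<open>The difference splits into a contraction of \<open>u - v\<close> and a change of the
  scaling factor applied to \<open>v\<close>; each costs at most \<open>norm (u - v)\<close>, whence
  the constant 2 in an arbitrary normed space.\<close>

lemma lipschitz_on_radial_retraction:
  assumes R: "R > 0"
  shows "2-lipschitz_on UNIV (radial_retraction R :: 'a::real_normed_vector \<Rightarrow> 'a)"
proof (rule lipschitz_onI)
  fix u v :: 'a
  define a where "a = max R (norm u)"
  define b where "b = max R (norm v)"
  have pos: "a > 0" "b > 0" and le: "R \<le> a" "norm v \<le> b" using R by (auto simp: a_def b_def)
  have "radial_retraction R u - radial_retraction R v = (R / a) *\<^sub>R (u - v) + ((b - a) * (R / a) / b) *\<^sub>R v"
    using pos by (simp add: radial_retraction_def algebra_simps flip: a_def b_def scaleR_add_left)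
      (simp add: field_simps)
  then have "norm (radial_retraction R u - radial_retraction R v)
      \<le> norm ((R / a) *\<^sub>R (u - v)) + norm (((b - a) * (R / a) / b) *\<^sub>R v)"
    by (simp only: norm_triangle_ineq)
  also have "\<dots> = (R / a) * norm (u - v) + \<bar>b - a\<bar> * ((R / a) * (norm v / b))"
    using pos R by (simp add: abs_mult)
  also have "\<dots> \<le> 1 * norm (u - v) + norm (u - v) * (1 * 1)"
  proof (intro add_mono mult_mono)
    show "\<bar>b - a\<bar> \<le> norm (u - v)"
      using norm_triangle_ineq3[of u v] by (auto simp: a_def b_def)
  qed (use pos le R in auto)
  finally show "dist (radial_retraction R u) (radial_retraction R v) \<le> 2 * dist u v"
    by (simp add: dist_norm)
qed simp

lemma has_real_derivative_norm_squared:
  fixes u :: "real \<Rightarrow> 'a::real_inner"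
  assumes "(u has_vector_derivative u') (at t within S)"
  shows "((\<lambda>t. (norm (u t))\<^sup>2) has_real_derivative 2 * (u t \<bullet> u')) (at t within S)"
  unfolding has_field_derivative_def power2_norm_eq_inner
  using assms unfolding has_vector_derivative_def
  by (auto intro!: derivative_eq_intros simp: inner_commute fun_eq_iff)

text \<open>The constant may depend on the radius, as the quadratic and cubic terms of the lattice
  field force it to.\<close>

definition lipschitz_on_balls :: "('a::real_normed_vector \<Rightarrow> 'b::real_normed_vector) \<Rightarrow> bool" where
  "lipschitz_on_balls F \<longleftrightarrow> (\<forall>R. \<exists>L. L-lipschitz_on (cball 0 R) F)"

locale dissipative_field =
  fixes F :: "'a::{real_inner,banach} \<Rightarrow> 'a" and \<kappa> c :: real
  assumes lipschitz: "lipschitz_on_balls F"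
    and dissipative: "\<And>u. u \<bullet> F u \<le> - \<kappa> * (norm u)\<^sup>2 + c * norm u"
    and \<kappa>_pos: "\<kappa> > 0" and c_nonneg: "c \<ge> 0"
begin

text \<open>Half of the decay rate \<open>2 * \<kappa>\<close> is given up to absorb the linear term
  by Young's inequality; the equilibrium of the resulting linear inequality for the squared norm is
  exactly \<open>(c / \<kappa>)\<^sup>2\<close>.\<close>

lemma solves_ivp_norm_bound:
  assumes "solves_ivp F u0 u" and "t \<ge> 0"
  shows "(norm (u t))\<^sup>2 \<le> exp (- \<kappa> * t) * (norm u0)\<^sup>2 + (c / \<kappa>)\<^sup>2"
proof -
  have "(norm (u t))\<^sup>2 \<le> exp (- \<kappa> * t) * ((norm (u 0))\<^sup>2 + (c\<^sup>2 / \<kappa>) / (- \<kappa>)) - (c\<^sup>2 / \<kappa>) / (- \<kappa>)"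
  proof (rule gronwall_halfline[OF has_real_derivative_norm_squared])
    fix s :: real assume s: "s \<ge> 0"
    show "(u has_vector_derivative F (u s)) (at s within {0..})"
      using assms(1) s by (simp add: solves_ivp_def)
    have "0 \<le> (\<kappa> * norm (u s) - c)\<^sup>2 / \<kappa>" using \<kappa>_pos by simp
    also have "\<dots> = \<kappa> * (norm (u s))\<^sup>2 - 2 * c * norm (u s) + c\<^sup>2 / \<kappa>"
      using \<kappa>_pos by (simp add: field_simps power2_eq_square)
    finally show "2 * (u s \<bullet> F (u s)) \<le> - \<kappa> * (norm (u s))\<^sup>2 + c\<^sup>2 / \<kappa>"
      using dissipative[of "u s"] by simp
  qed (use assms \<kappa>_pos in auto)
  also have "\<dots> = exp (- \<kappa> * t) * (norm u0)\<^sup>2 + (c / \<kappa>)\<^sup>2 - exp (- \<kappa> * t) * (c / \<kappa>)\<^sup>2"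
    using assms(1) \<kappa>_pos by (simp add: solves_ivp_def field_simps power2_eq_square)
  also have "\<dots> \<le> exp (- \<kappa> * t) * (norm u0)\<^sup>2 + (c / \<kappa>)\<^sup>2" by simp
  finally show ?thesis .
qed

lemma solves_ivp_norm_le:
  assumes "solves_ivp F u0 u" and "t \<ge> 0" and "norm u0 \<le> r"
  shows "norm (u t) \<le> r + c / \<kappa>"
proof (rule power2_le_imp_le)
  have r: "r \<ge> 0" using assms(3) norm_ge_zero order_trans by blast
  have "(norm (u t))\<^sup>2 \<le> exp (- \<kappa> * t) * (norm u0)\<^sup>2 + (c / \<kappa>)\<^sup>2"
    by (rule solves_ivp_norm_bound[OF assms(1,2)])
  also have "\<dots> \<le> 1 * r\<^sup>2 + (c / \<kappa>)\<^sup>2"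
    using assms \<kappa>_pos by (intro add_mono mult_mono power_mono order_refl) auto
  also have "\<dots> \<le> (r + c / \<kappa>)\<^sup>2"
    using r \<kappa>_pos c_nonneg by (simp add: power2_sum)
  finally show "(norm (u t))\<^sup>2 \<le> (r + c / \<kappa>)\<^sup>2" .
  show "0 \<le> r + c / \<kappa>" using r \<kappa>_pos c_nonneg by simp
qed

text \<open>Solutions starting in a fixed ball stay in one larger ball for all times, so a single
  Lipschitz constant enters Gronwall's inequality. Uniqueness and continuity of the flow both
  follow.\<close>

lemma solves_ivp_dist_le:
  "\<exists>L. \<forall>u0 v0 u v t. norm u0 \<le> r \<longrightarrow> norm v0 \<le> r \<longrightarrow> solves_ivp F u0 u \<longrightarrow> solves_ivp F v0 v \<longrightarrow> t \<ge> 0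
    \<longrightarrow> norm (u t - v t) \<le> exp (L * t) * norm (u0 - v0)"
proof -
  obtain L where L: "L-lipschitz_on (cball 0 (r + c / \<kappa>)) F"
    using lipschitz by (auto simp: lipschitz_on_balls_def)
  \<comment> \<open>\<open>L + 1\<close> in place of \<open>L\<close> keeps the Gronwall coefficient
    nonzero.\<close>
  have "norm (u t - v t) \<le> exp ((L + 1) * t) * norm (u0 - v0)"
    if "norm u0 \<le> r" "norm v0 \<le> r" and u: "solves_ivp F u0 u" and v: "solves_ivp F v0 v" and t: "t \<ge> 0"
    for u0 v0 u v t
  proof -
    have pos: "L + 1 > 0" using lipschitz_on_nonneg[OF L] by simp
    have "(norm (u t - v t))\<^sup>2 \<le> exp (2 * (L + 1) * t) * ((norm (u 0 - v 0))\<^sup>2 + 0 / (2 * (L + 1))) - 0 / (2 * (L + 1))"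
    proof (rule gronwall_halfline[OF has_real_derivative_norm_squared])
      fix s :: real assume s: "s \<ge> 0"
      show "((\<lambda>s. u s - v s) has_vector_derivative F (u s) - F (v s)) (at s within {0..})"
        using u v s by (auto simp: solves_ivp_def intro!: derivative_intros)
      have "(u s - v s) \<bullet> (F (u s) - F (v s)) \<le> norm (u s - v s) * norm (F (u s) - F (v s))"
        by (rule norm_cauchy_schwarz)
      also have "\<dots> \<le> norm (u s - v s) * (L * norm (u s - v s))"
        using solves_ivp_norm_le u v s that
        by (intro mult_left_mono lipschitz_on_normD[OF L]) auto
      also have "\<dots> \<le> (L + 1) * (norm (u s - v s))\<^sup>2"
        by (simp add: algebra_simps power2_eq_square)
      finally show "2 * ((u s - v s) \<bullet> (F (u s) - F (v s))) \<le> 2 * (L + 1) * (norm (u s - v s))\<^sup>2 + 0"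
        by linarith
    qed (use t pos in auto)
    also have "\<dots> = (exp ((L + 1) * t) * norm (u0 - v0))\<^sup>2"
      using u v by (simp add: solves_ivp_def power_mult_distrib mult.assoc flip: exp_double)
    finally show ?thesis by (rule power2_le_imp_le) simp
  qed
  then show ?thesis by blast
qed

lemma solves_ivp_unique:
  assumes "solves_ivp F u0 u" and "solves_ivp F u0 v" and "t \<ge> 0"
  shows "u t = v t"
proof -
  obtain L where "norm (u t - v t) \<le> exp (L * t) * norm (u0 - u0)"
    using solves_ivp_dist_le[of "norm u0"] assms by blast
  then show ?thesis by simp
qed

text \<open>Composing with a radial retraction makes the field globally Lipschitz, and it still points
  inwards outside the ball, so that the ball traps the solution.\<close>

lemma ivp_solvable: "\<exists>u. solves_ivp F u0 u"
proof -
  \<comment> \<open>The ball must contain \<open>u0\<close> and have radius at least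
    \<open>c / \<kappa>\<close>, so that the field does not point outwards on its sphere; the 1
    ensures \<open>R > 0\<close>.\<close>
  define R where "R = norm u0 + c / \<kappa> + 1"
  have R: "R > 0" "norm u0 \<le> R" "c \<le> \<kappa> * R"
    using \<kappa>_pos c_nonneg by (auto simp: R_def algebra_simps add_pos_nonneg)
  obtain L where L: "L-lipschitz_on (cball 0 R) F" using lipschitz by (auto simp: lipschitz_on_balls_def)
  have "(L * 2)-lipschitz_on UNIV (F \<circ> radial_retraction R)"
    using norm_radial_retraction_le[OF R(1)]
    by (intro lipschitz_on_compose lipschitz_on_radial_retraction R lipschitz_on_subset[OF L]) auto
  then obtain u where u: "solves_ivp (F \<circ> radial_retraction R) u0 u"
    using lipschitz_ivp_solvable by blast
  have inside: "norm (u t) \<le> R" if "t \<ge> 0" for t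
  proof (rule power2_le_imp_le)
    show "(norm (u t))\<^sup>2 \<le> R\<^sup>2"
    proof (rule barrier_halfline[OF has_real_derivative_norm_squared _ _ that])
      fix s :: real assume s: "s \<ge> 0"
      show "(u has_vector_derivative F (radial_retraction R (u s))) (at s within {0..})"
        using u s by (simp add: solves_ivp_def)
      assume "R\<^sup>2 < (norm (u s))\<^sup>2"
      then have out: "R < norm (u s)" using power2_less_imp_less norm_ge_zero by blast
      \<comment> \<open>Outside the ball, \<open>u s\<close> is the multiple \<open>a\<close> of its
        retraction \<open>p\<close>. Hence \<open>u s \<bullet> F p\<close> inherits the sign of
        \<open>p \<bullet> F p\<close>, which dissipativity determines because
        \<open>norm p = R\<close>.\<close>
      define a where "a = norm (u s) / R"
      define p where "p = radial_retraction R (u s)"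
      have us: "u s = a *\<^sub>R p" and p: "norm p = R" and a: "a \<ge> 0"
        using out R by (auto simp: a_def p_def radial_retraction_def max_def)
      have "p \<bullet> F p \<le> - \<kappa> * (norm p)\<^sup>2 + c * norm p" by (rule dissipative)
      also have "\<dots> = (c - \<kappa> * R) * R" by (simp add: p power2_eq_square algebra_simps)
      also have "\<dots> \<le> 0" using R by (intro mult_nonpos_nonneg) auto
      finally have "a * (p \<bullet> F p) \<le> 0" using a by (simp add: mult_nonneg_nonpos)
      moreover have "u s \<bullet> F p = a * (p \<bullet> F p)" by (simp add: us)
      ultimately show "2 * (u s \<bullet> F (radial_retraction R (u s))) \<le> 0"
        unfolding p_def[symmetric] by linarith
    next
      have "u 0 = u0" using u unfolding solves_ivp_def by blast
      then show "(norm (u 0))\<^sup>2 \<le> R\<^sup>2" using R by (simp add: power_mono)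
    qed
  qed (use R in simp)
  have "solves_ivp F u0 u"
    using u inside R by (simp add: solves_ivp_def radial_retraction_id)
  then show ?thesis by blast
qed

section \<open>The solution semigroup and its absorbing ball\<close>

lemma solution_eq:
  assumes "solves_ivp F u0 u" and "t \<ge> 0"
  shows "solution F t u0 = u t"
  unfolding solution_def using assms solves_ivp_unique by blast

lemma solves_ivp_solution: "solves_ivp F u0 (\<lambda>t. solution F t u0)"
proof -
  obtain u where u: "solves_ivp F u0 u" using ivp_solvable ..
  have "(u has_vector_derivative F (u t)) (at t within {0..}) =
      ((\<lambda>t. solution F t u0) has_vector_derivative F (u t)) (at t within {0..})" if "t \<ge> 0" for t
    using that by (intro has_vector_derivative_cong_ev)  (auto simp: solution_eq[OF u] eventually_at_filter)
  moreover have "continuous_on {0..} u = continuous_on {0..} (\<lambda>t. solution F t u0)"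
    by (intro continuous_on_cong) (auto simp: solution_eq[OF u])
  ultimately show ?thesis using u by (simp add: solves_ivp_def solution_eq[OF u])
qed

text \<open>The field is autonomous, so a time translate of a solution is again a solution, and
  uniqueness identifies it.\<close>

lemma solution_add:
  assumes "s \<ge> 0" and "t \<ge> 0"
  shows "solution F (s + t) u0 = solution F t (solution F s u0)"
proof (rule solution_eq[OF _ assms(2), symmetric])
  let ?u = "\<lambda>t. solution F t u0"
  have u: "solves_ivp F u0 ?u" by (rule solves_ivp_solution)
  have deriv: "((\<lambda>t. ?u (s + t)) has_vector_derivative F (?u (s + r))) (at r within {0..})" if "r \<ge> 0" for r
  proof -
    have "(?u has_vector_derivative F (?u (s + r))) (at (s + r) within {0..})"
      using u that assms unfolding solves_ivp_def by (metis add_nonneg_nonneg)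
    then have "(?u has_vector_derivative F (?u (s + r))) (at (s + r) within (\<lambda>t. s + t) ` {0..})"
      by (rule has_vector_derivative_within_subset) (use assms in auto)
    moreover have "((\<lambda>t. s + t) has_vector_derivative 1) (at r within {0..})"
      by (auto intro!: derivative_eq_intros)
    ultimately show ?thesis
      using vector_diff_chain_within[of "\<lambda>t. s + t" 1 r "{0..}" ?u] by (simp add: o_def)
  qed
  then have "continuous_on {0..} (\<lambda>t. ?u (s + t))"
    by (auto simp: continuous_on_eq_continuous_within intro: has_vector_derivative_continuous)
  with deriv show "solves_ivp F (solution F s u0) (\<lambda>t. ?u (s + t))"
    by (simp add: solves_ivp_def)
qed

lemma continuous_on_solution:
  assumes "t \<ge> 0"
  shows "continuous_on UNIV (solution F t)"
proof -
  have "isCont (solution F t) x" for x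
  proof -
    obtain L where L: "\<And>u v. norm u \<le> norm x + 1 \<Longrightarrow> norm v \<le> norm x + 1 \<Longrightarrow>
        norm (solution F t u - solution F t v) \<le> exp (L * t) * norm (u - v)"
      using solves_ivp_dist_le[of "norm x + 1"] solves_ivp_solution assms by metis
    have "(exp (L * t))-lipschitz_on (ball x 1) (solution F t)"
    proof (rule lipschitz_onI)
      fix u v assume "u \<in> ball x 1" "v \<in> ball x 1"
      then have "norm u \<le> norm x + 1" "norm v \<le> norm x + 1"
        using norm_triangle_sub[of u x] norm_triangle_sub[of v x]
        by (auto simp: dist_norm norm_minus_commute)
      then show "dist (solution F t u) (solution F t v) \<le> exp (L * t) * dist u v"
        using L by (simp add: dist_norm)
    qed simp
    then have "continuous_on (ball x 1) (solution F t)" by (rule lipschitz_on_continuous_on)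
    then show ?thesis by (simp add: continuous_on_eq_continuous_at)
  qed
  then show ?thesis by (simp add: continuous_on_eq_continuous_at)
qed

text \<open>The entry time comes from \<open>x * exp (- x) \<le> 1\<close> with
  \<open>x = \<kappa> * t \<ge> r\<^sup>2\<close>: the initial energy has then decayed to at most 1,
  which the 1 in the radius accommodates.\<close>

lemma solution_absorbed:
  assumes "norm u0 \<le> r" and "t \<ge> r\<^sup>2 / \<kappa>"
  shows "norm (solution F t u0) \<le> 1 + c / \<kappa>"
proof (rule power2_le_imp_le)
  have t: "t \<ge> 0" using assms(2) \<kappa>_pos by (smt (verit) zero_le_divide_iff zero_le_power2)
  have "exp (- \<kappa> * t) * (norm u0)\<^sup>2 \<le> exp (- \<kappa> * t) * (\<kappa> * t)"
    using assms \<kappa>_pos power_mono[OF assms(1), of 2]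
    by (intro mult_left_mono) (auto simp: field_simps)
  also have "\<dots> \<le> exp (- \<kappa> * t) * exp (\<kappa> * t)"
    using exp_ge_add_one_self[of "\<kappa> * t"] by (intro mult_left_mono) (linarith, simp)
  also have "\<dots> = 1" by (simp add: mult_exp_exp)
  finally have "(norm (solution F t u0))\<^sup>2 \<le> 1 + (c / \<kappa>)\<^sup>2"
    using solves_ivp_norm_bound[OF solves_ivp_solution t, of u0] by simp
  also have "\<dots> \<le> (1 + c / \<kappa>)\<^sup>2" using \<kappa>_pos c_nonneg by (simp add: power2_sum)
  finally show "(norm (solution F t u0))\<^sup>2 \<le> (1 + c / \<kappa>)\<^sup>2" .
qed (use \<kappa>_pos c_nonneg in simp)

end

section \<open>Omega-limit sets as global attractors\<close>

text \<open>By invariance each \<open>a\<close> in \<open>A\<close> is, for every \<open>t\<close>,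
  the time-\<open>t\<close> image of a point of \<open>A\<close>. Attraction by \<open>B\<close> at
  large \<open>t\<close> therefore places \<open>a\<close> itself arbitrarily close to
  \<open>B\<close>, which is closed.\<close>

lemma global_attractor_subset:
  assumes A: "global_attractor F A" and B: "global_attractor F B"
  shows "A \<subseteq> B"
proof
  fix a assume a: "a \<in> A"
  have "bounded A" using A by (simp add: global_attractor_def compact_imp_bounded)
  then obtain r where r: "r > 0" "A \<subseteq> cball 0 r"
    unfolding bounded_pos by (auto simp: subset_iff)
  have near: "\<exists>b\<in>B. dist b a < e" if "e > 0" for e
  proof -
    have "((\<lambda>t. hausdorff_semidist (solution F t ` cball 0 r) B) \<longlongrightarrow> 0) at_top"
      using B r by (simp add: global_attractor_def)
    then have "\<forall>\<^sub>F t in at_top. hausdorff_semidist (solution F t ` cball 0 r) B < ennreal e"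
      using that by (intro order_tendstoD) auto
    then obtain t where "t \<ge> 0" and t: "hausdorff_semidist (solution F t ` cball 0 r) B < ennreal e"
      using eventually_happens'[OF _ eventually_conj[OF eventually_ge_at_top]] by (metis trivial_limit_at_top_linorder)
    have "a \<in> solution F t ` A" using A a \<open>t \<ge> 0\<close> by (simp add: global_attractor_def)
    then have "a \<in> solution F t ` cball 0 r" using r by blast
    then have "(INF b\<in>B. ennreal (norm (a - b))) \<le> hausdorff_semidist (solution F t ` cball 0 r) B"
      unfolding hausdorff_semidist_def by (rule SUP_upper)
    also note t
    finally show ?thesis
      using that by (auto simp: INF_less_iff dist_norm norm_minus_commute ennreal_less_iff)
  qed
  have "closed B" using B by (simp add: global_attractor_def compact_imp_closed)
  moreover have "a \<in> closure B" using near by (simp add: closure_approachable)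
  ultimately show "a \<in> B" by simp
qed

lemma hausdorff_semidist_tendsto_0:
  assumes "\<And>e. e > 0 \<Longrightarrow> \<forall>\<^sub>F t in G. \<forall>x\<in>X t. \<exists>a\<in>A. norm (x - a) < e"
  shows "((\<lambda>t. hausdorff_semidist (X t) A) \<longlongrightarrow> 0) G"
proof (rule order_tendstoI)
  fix a :: ennreal assume "0 < a"
  \<comment> \<open>\<open>a\<close> may be infinite, and the supremum yields only a non-strict
    bound; the intermediate \<open>b\<close> is finite and leaves room.\<close>
  then obtain b where b: "0 < b" "b < a" using dense by blast
  then have "b < top" using less_le_trans top_greatest by blast
  then obtain e where e: "b = ennreal e" "e > 0"
    using b by (cases b) auto
  show "\<forall>\<^sub>F t in G. hausdorff_semidist (X t) A < a"
    using assms[OF e(2)]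
  proof eventually_elim
    case (elim t)
    have "hausdorff_semidist (X t) A \<le> b"
      unfolding hausdorff_semidist_def
    proof (rule SUP_least)
      fix x assume "x \<in> X t"
      with elim obtain y where "y \<in> A" "norm (x - y) < e" by blast
      then show "(INF y\<in>A. ennreal (norm (x - y))) \<le> b"
        unfolding e by (intro INF_lower2[of y]) (auto intro!: ennreal_leI)
    qed
    then show ?case using b by simp
  qed
qed simp

text \<open>The compactness hypothesis concerns data from the absorbing ball only; every other ball
  enters it after a finite time.\<close>

locale asymptotically_compact_field = dissipative_field +
  assumes asymptotically_compact:
    "\<And>s x. (\<And>n. s n \<ge> 0) \<Longrightarrow> filterlim s at_top sequentially \<Longrightarrow> (\<And>n. norm (x n) \<le> 1 + c / \<kappa>) \<Longrightarrow>
      \<exists>l r. strict_mono (r :: nat \<Rightarrow> nat) \<and> (\<lambda>n. solution F (s (r n)) (x (r n))) \<longlonglongrightarrow> l"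
begin

definition omega_limit :: "'a set" where
  "omega_limit = (\<Inter>T\<in>{0<..}. closure (\<Union>t\<in>{T..}. solution F t ` cball 0 (1 + c / \<kappa>)))"

lemma omega_limit_approx:
  assumes "y \<in> omega_limit"
  shows "\<exists>s x. real n \<le> s \<and> norm x \<le> 1 + c / \<kappa> \<and> dist (solution F s x) y < 1 / real (Suc n)"
proof -
  \<comment> \<open>The intersection ranges over positive \<open>T\<close>, hence
    \<open>Suc n\<close> rather than \<open>n\<close>.\<close>
  have "y \<in> closure (\<Union>t\<in>{real (Suc n)..}. solution F t ` cball 0 (1 + c / \<kappa>))"
    using assms by (auto simp: omega_limit_def)
  then obtain z where "z \<in> (\<Union>t\<in>{real (Suc n)..}. solution F t ` cball 0 (1 + c / \<kappa>))"
    and "dist z y < 1 / real (Suc n)"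
    unfolding closure_approachable by (meson of_nat_0_less_iff zero_less_Suc zero_less_divide_1_iff)
  then obtain s x where "real (Suc n) \<le> s" "norm x \<le> 1 + c / \<kappa>" "dist (solution F s x) y < 1 / real (Suc n)"
    by auto
  moreover from this have "real n \<le> s" by simp
  ultimately show ?thesis by blast
qed

text \<open>With the converse \<open>omega_limit_sequence\<close>, this describes the omega-limit
  set by limits along diverging times; invariance is proved through that description.\<close>

lemma omega_limitI:
  assumes s: "filterlim s at_top sequentially" and x: "\<And>n. norm (x n) \<le> 1 + c / \<kappa>"
    and lim: "(\<lambda>n. solution F (s n) (x n)) \<longlonglongrightarrow> y"
  shows "y \<in> omega_limit"
  unfolding omega_limit_def
proof
  fix T :: real
  let ?K = "\<Union>t\<in>{T..}. solution F t ` cball 0 (1 + c / \<kappa>)"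
  have "\<forall>\<^sub>F n in sequentially. s n \<ge> T" using s by (simp add: filterlim_at_top)
  then have "\<forall>\<^sub>F n in sequentially. solution F (s n) (x n) \<in> closure ?K"
  proof eventually_elim
    case (elim n)
    have "solution F (s n) (x n) \<in> solution F (s n) ` cball 0 (1 + c / \<kappa>)"
      using x[of n] by (intro imageI) simp
    then have "solution F (s n) (x n) \<in> ?K" using elim by blast
    then show ?case by (rule subsetD[OF closure_subset])
  qed
  then show "y \<in> closure ?K"
    by (rule Lim_in_closed_set[OF closed_closure _ sequentially_bot lim])
qed

lemma omega_limit_sequence:
  assumes "y \<in> omega_limit"
  shows "\<exists>s x. (\<forall>n. s n \<ge> 0 \<and> norm (x n) \<le> 1 + c / \<kappa>) \<and> filterlim s at_top sequentially \<and>
    (\<lambda>n. solution F (s n) (x n)) \<longlonglongrightarrow> y"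
proof -
  obtain s x where *: "\<And>n. real n \<le> s n" "\<And>n. norm (x n) \<le> 1 + c / \<kappa>"
    "\<And>n. dist (solution F (s n) (x n)) y < 1 / real (Suc n)"
    using omega_limit_approx[OF assms] by metis
  have "s n \<ge> 0" for n using *(1)[of n] by linarith
  moreover have "filterlim s at_top sequentially"
    by (rule filterlim_at_top_mono[OF filterlim_real_sequentially]) (simp add: *)
  moreover have "(\<lambda>n. 1 / real (Suc n)) \<longlonglongrightarrow> 0"
    using LIMSEQ_inverse_real_of_nat by (simp add: inverse_eq_divide)
  then have "(\<lambda>n. dist (solution F (s n) (x n)) y) \<longlonglongrightarrow> 0"
    by (rule tendsto_0_le[where K = 1]) (auto intro!: always_eventually less_imp_le[OF *(3)] simp del: of_nat_Suc)
  then have "(\<lambda>n. solution F (s n) (x n)) \<longlonglongrightarrow> y" by (simp add: tendsto_dist_iff[of _ y])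
  ultimately show ?thesis using *(2) by blast
qed

lemma subsequence_limit_in_omega_limit:
  assumes "\<And>n. s n \<ge> 0" "filterlim s at_top sequentially" "\<And>n. norm (x n) \<le> 1 + c / \<kappa>"
  shows "\<exists>l\<in>omega_limit. \<exists>r. strict_mono (r :: nat \<Rightarrow> nat) \<and> (\<lambda>n. solution F (s (r n)) (x (r n))) \<longlonglongrightarrow> l"
proof -
  obtain l r where lr: "strict_mono (r :: nat \<Rightarrow> nat)" "(\<lambda>n. solution F (s (r n)) (x (r n))) \<longlonglongrightarrow> l"
    using asymptotically_compact[of s x, OF assms] by blast
  have "filterlim (\<lambda>n. s (r n)) at_top sequentially"
    using assms(2) filterlim_subseq[OF lr(1)] by (rule filterlim_compose)
  then have "l \<in> omega_limit" by (rule omega_limitI[OF _ _ lr(2)]) (rule assms)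
  with lr show ?thesis by blast
qed

text \<open>Each \<open>y n\<close> is replaced by a trajectory point at time at least
  \<open>n\<close> and at distance below \<open>1 / (n + 1)\<close>. Asymptotic compactness applies
  to these points, and the \<open>y n\<close> share the limit of the chosen subsequence.\<close>

lemma compact_omega_limit: "compact omega_limit"
  unfolding compact_eq_seq_compact_metric
proof (rule seq_compactI)
  fix y :: "nat \<Rightarrow> 'a" assume "\<forall>n. y n \<in> omega_limit"
  then have "\<forall>n. \<exists>s x. real n \<le> s \<and> norm x \<le> 1 + c / \<kappa> \<and> dist (solution F s x) (y n) < 1 / real (Suc n)"
    by (intro allI omega_limit_approx) (rule spec)
  then obtain s x where *: "\<And>n. real n \<le> s n" "\<And>n. norm (x n) \<le> 1 + c / \<kappa>"
    "\<And>n. dist (solution F (s n) (x n)) (y n) < 1 / real (Suc n)"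
    by metis
  have "s n \<ge> 0" for n using *(1)[of n] by linarith
  moreover have "filterlim s at_top sequentially"
    by (rule filterlim_at_top_mono[OF filterlim_real_sequentially]) (simp add: *)
  ultimately obtain l r where lr: "strict_mono r" "(\<lambda>n. solution F (s (r n)) (x (r n))) \<longlonglongrightarrow> l" "l \<in> omega_limit"
    using subsequence_limit_in_omega_limit[of s x, OF _ _ *(2)] by blast
  have "(\<lambda>n. 1 / real (Suc n)) \<longlonglongrightarrow> 0" using LIMSEQ_inverse_real_of_nat by (simp add: inverse_eq_divide)
  then have "(\<lambda>n. 1 / real (Suc (r n))) \<longlonglongrightarrow> 0"
    by (rule filterlim_compose[OF _ filterlim_subseq[OF lr(1)]])
  then have "(\<lambda>n. solution F (s (r n)) (x (r n)) - y (r n)) \<longlonglongrightarrow> 0"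
    by (rule tendsto_0_le[where K = 1]) (use less_imp_le[OF *(3)] in \<open>auto simp: dist_norm intro!: always_eventually simp del: of_nat_Suc\<close>)
  then have "(\<lambda>n. y (r n)) \<longlonglongrightarrow> l"
    by (rule Lim_transform2[OF lr(2)])
  with lr show "\<exists>l\<in>omega_limit. \<exists>r. strict_mono r \<and> (y \<circ> r) \<longlonglongrightarrow> l"
    by (auto simp: o_def)
qed

text \<open>Forward invariance is continuity of the time-\<open>t\<close> map. For the reverse
  inclusion the approximating trajectories are stopped \<open>t\<close> earlier; a subsequence of
  the earlier points converges, and its limit is a preimage of \<open>y\<close>.\<close>

lemma omega_limit_invariant:
  assumes "t \<ge> 0"
  shows "solution F t ` omega_limit = omega_limit"
proof (intro equalityI subsetI)
  have cont: "(\<lambda>n. solution F t (z n)) \<longlonglongrightarrow> solution F t l" if "z \<longlonglongrightarrow> l" for z l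
    using continuous_on_tendsto_compose[OF continuous_on_solution[OF assms] that] by simp
  fix y
  {
    assume "y \<in> solution F t ` omega_limit"
    then obtain z where z: "z \<in> omega_limit" "y = solution F t z" by blast
    from z(1) obtain s x where s: "\<And>n. s n \<ge> 0" "filterlim s at_top sequentially"
      "\<And>n. norm (x n) \<le> 1 + c / \<kappa>" "(\<lambda>n. solution F (s n) (x n)) \<longlonglongrightarrow> z"
      using omega_limit_sequence by blast
    show "y \<in> omega_limit"
    proof (rule omega_limitI)
      show "filterlim (\<lambda>n. s n + t) at_top sequentially"
        by (rule filterlim_at_top_mono[OF s(2)]) (use assms in auto)
      show "(\<lambda>n. solution F (s n + t) (x n)) \<longlonglongrightarrow> y"
        using cont[OF s(4)] s(1) assms by (simp add: solution_add z)
    qed (rule s)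
  }
  {
    assume "y \<in> omega_limit"
    then obtain s x where s: "\<And>n. s n \<ge> 0" "filterlim s at_top sequentially"
      "\<And>n. norm (x n) \<le> 1 + c / \<kappa>" "(\<lambda>n. solution F (s n) (x n)) \<longlonglongrightarrow> y"
      using omega_limit_sequence by blast
    \<comment> \<open>The maximum only matters for finitely many \<open>n\<close>, where
      \<open>s n\<close> is still below \<open>t\<close>.\<close>
    define s' where "s' n = max 0 (s n - t)" for n
    have "filterlim (\<lambda>n. - t + s n) at_top sequentially"
      by (rule filterlim_tendsto_add_at_top[OF tendsto_const s(2)])
    then have "filterlim s' at_top sequentially"
      by (rule filterlim_at_top_mono) (auto simp: s'_def)
    moreover have "s' n \<ge> 0" for n by (simp add: s'_def)
    ultimately obtain l r where lr: "strict_mono r" "(\<lambda>n. solution F (s' (r n)) (x (r n))) \<longlonglongrightarrow> l" "l \<in> omega_limit"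
      using subsequence_limit_in_omega_limit[of s' x, OF _ _ s(3)] by blast
    have "filterlim (\<lambda>n. s (r n)) at_top sequentially"
      using s(2) filterlim_subseq[OF lr(1)] by (rule filterlim_compose)
    then have "\<forall>\<^sub>F n in sequentially. s (r n) \<ge> t" by (simp add: filterlim_at_top)
    then have "\<forall>\<^sub>F n in sequentially.
        solution F t (solution F (s' (r n)) (x (r n))) = solution F (s (r n)) (x (r n))"
    proof eventually_elim
      case (elim n)
      then show ?case
        using solution_add[of "s' (r n)" t "x (r n)"] assms by (simp add: s'_def)
    qed
    then have "(\<lambda>n. solution F (s (r n)) (x (r n))) \<longlonglongrightarrow> solution F t l"
      using cont[OF lr(2)] by (rule Lim_transform_eventually[rotated])
    moreover have "(\<lambda>n. solution F (s (r n)) (x (r n))) \<longlonglongrightarrow> y"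
      using LIMSEQ_subseq_LIMSEQ[OF s(4) lr(1)] by (simp add: o_def)
    ultimately have "y = solution F t l" using LIMSEQ_unique by blast
    then show "y \<in> solution F t ` omega_limit" using lr by blast
  }
qed

text \<open>If attraction failed, there would be trajectories from the ball staying \<open>e\<close>
  away at diverging times. Restarted at the common entry time \<open>T\<close>, they begin in the
  absorbing ball, so a subsequence converges into the omega-limit set.\<close>

lemma omega_limit_attracts:
  assumes "e > 0"
  shows "\<forall>\<^sub>F t in at_top. \<forall>x\<in>solution F t ` cball 0 r. \<exists>a\<in>omega_limit. norm (x - a) < e"
proof (rule ccontr)
  define T where "T = r\<^sup>2 / \<kappa>"
  have T: "T \<ge> 0" using \<kappa>_pos by (simp add: T_def)
  assume "\<not> ?thesis"
  then have "\<forall>N. \<exists>t\<ge>N. \<exists>u\<in>cball 0 r. \<forall>a\<in>omega_limit. e \<le> norm (solution F t u - a)"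
    unfolding eventually_at_top_linorder by (metis imageE not_le)
  then have "\<forall>n. \<exists>t u. t \<ge> real n + T \<and> norm u \<le> r \<and> (\<forall>a\<in>omega_limit. e \<le> norm (solution F t u - a))"
    by (metis mem_cball_0)
  then obtain t u where tu: "\<And>n. t n \<ge> real n + T" "\<And>n. norm (u n) \<le> r"
    "\<And>n a. a \<in> omega_limit \<Longrightarrow> e \<le> norm (solution F (t n) (u n) - a)"
    by metis
  define s x where "s n = t n - T" and "x n = solution F T (u n)" for n
  have s: "real n \<le> s n" "s n \<ge> 0" for n using tu(1)[of n] by (auto simp: s_def)
  have x: "norm (x n) \<le> 1 + c / \<kappa>" for n
    unfolding x_def using solution_absorbed[OF tu(2)] by (simp add: T_def)
  have "filterlim s at_top sequentially"
    by (rule filterlim_at_top_mono[OF filterlim_real_sequentially]) (simp add: s)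
  then obtain l q where lq: "strict_mono q" "(\<lambda>n. solution F (s (q n)) (x (q n))) \<longlonglongrightarrow> l" "l \<in> omega_limit"
    using subsequence_limit_in_omega_limit[of s x, OF s(2) _ x] by blast
  have eq: "solution F (s n) (x n) = solution F (t n) (u n)" for n
    using solution_add[OF T s(2)[of n], of "u n"] by (simp add: x_def s_def)
  obtain n where "norm (solution F (t (q n)) (u (q n)) - l) < e"
    using LIMSEQ_D[OF lq(2) assms] by (auto simp: eq)
  with tu(3)[OF lq(3), of "q n"] show False by simp
qed

theorem global_attractor_omega_limit: "global_attractor F omega_limit"
  unfolding global_attractor_def
  by (intro conjI allI impI compact_omega_limit omega_limit_invariant hausdorff_semidist_tendsto_0
      omega_limit_attracts)

theorem global_attractor_iff: "global_attractor F A \<longleftrightarrow> A = omega_limit"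
  using global_attractor_omega_limit global_attractor_subset[of F] by (blast intro: antisym)

end

section \<open>Energy estimates on the sequence space\<close>

instance ell2 :: banach ..

lift_definition shift :: "int \<Rightarrow> ell2 \<Rightarrow> ell2" is "\<lambda>k u i. u (i + k)"
  by (rule square_summable_shift)

lift_definition pmul :: "ell2 \<Rightarrow> ell2 \<Rightarrow> ell2" is "\<lambda>u v i. u i * v i"
  by (rule square_summable_mult)

text \<open>Clamping \<open>\<theta>\<close> to the unit interval keeps the multiplier bounded for every \<open>\<theta>\<close>.\<close>

lift_definition weight :: "(int \<Rightarrow> real) \<Rightarrow> ell2 \<Rightarrow> ell2" is "\<lambda>\<theta> u i. max 0 (min 1 (\<theta> i)) * u i"
proof -
  fix \<theta> u :: "int \<Rightarrow> real"
  assume "square_summable u"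
  moreover have "(max 0 (min 1 (\<theta> i)) * u i)\<^sup>2 \<le> (u i)\<^sup>2" for i
    by (auto simp: power_mult_distrib power_le_one mult_left_le_one_le)
  ultimately show "square_summable (\<lambda>i. max 0 (min 1 (\<theta> i)) * u i)"
    unfolding square_summable_def by (rule summable_on_comparison_test) auto
qed

lemma norm_ell2_le:
  assumes "\<And>i. \<bar>component u i\<bar> \<le> \<bar>component v i\<bar>"
  shows "norm u \<le> norm v"
proof (rule power2_le_imp_le)
  show "(norm u)\<^sup>2 \<le> (norm v)\<^sup>2"
    unfolding norm_ell2_squared
    using square_summable_component[of u] square_summable_component[of v] assms
    by (intro infsum_mono) (auto simp: square_summable_def abs_le_square_iff)
qed simp

lemma norm_shift: "norm (shift k u) = norm u"
proof -
  have "bij_betw (\<lambda>i. i + k) UNIV (UNIV :: int set)"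
    by (rule bij_betw_byWitness[where f' = "\<lambda>i. i - k"]) auto
  from infsum_reindex_bij_betw[OF this, of "\<lambda>i. (component u i)\<^sup>2"]
  have "(norm (shift k u))\<^sup>2 = (norm u)\<^sup>2"
    by (simp add: norm_ell2_squared shift.rep_eq)
  then show ?thesis by simp
qed

text \<open>One factor is bounded by its supremum, which the square-sum norm dominates.\<close>

lemma norm_pmul_le: "norm (pmul u v) \<le> norm u * norm v"
proof -
  have "norm (pmul u v) \<le> norm (norm u *\<^sub>R v)"
    by (rule norm_ell2_le)
      (simp add: pmul.rep_eq scaleR_ell2.rep_eq abs_mult mult_right_mono abs_component_le_norm)
  then show ?thesis by simp
qed

lemma shift_diff: "shift k (u - v) = shift k u - shift k v"
  by transfer simp

lemma pmul_diff: "pmul u v - pmul u' v' = pmul (u - u') v + pmul u' (v - v')"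
  by transfer (simp add: algebra_simps)

text \<open>The expanded form avoids the constant sequence 1 and is built from operations on the
  sequence space, so that the Lipschitz property can be assembled term by term.\<close>

lemma lattice_field_eq:
  "lattice_field \<nu> \<alpha> \<beta> \<gamma> lam f u =
    \<nu> *\<^sub>R (2 *\<^sub>R u - shift (-1) u - shift 1 u) - \<alpha> *\<^sub>R pmul u (shift (-1) u - u)
    + \<beta> *\<^sub>R ((1 + \<gamma>) *\<^sub>R pmul u u - pmul u (pmul u u) - \<gamma> *\<^sub>R u) - lam *\<^sub>R u + f"
  by transfer (simp add: fun_eq_iff lattice_Lambda_def lattice_Dminus_def algebra_simps)

section \<open>Calculus of maps that are Lipschitz on balls\<close>

lemma lipschitz_on_balls_const: "lipschitz_on_balls (\<lambda>u. a)"
  unfolding lipschitz_on_balls_def by (blast intro: lipschitz_on_constant)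

lemma lipschitz_on_balls_id: "lipschitz_on_balls (\<lambda>u. u)"
  unfolding lipschitz_on_balls_def by (blast intro: lipschitz_on_id)

lemma lipschitz_on_balls_add:
  "lipschitz_on_balls F \<Longrightarrow> lipschitz_on_balls G \<Longrightarrow> lipschitz_on_balls (\<lambda>u. F u + G u)"
  unfolding lipschitz_on_balls_def by (blast intro: lipschitz_on_add)

lemma lipschitz_on_balls_diff:
  "lipschitz_on_balls F \<Longrightarrow> lipschitz_on_balls G \<Longrightarrow> lipschitz_on_balls (\<lambda>u. F u - G u)"
  unfolding lipschitz_on_balls_def by (blast intro: lipschitz_on_diff)

lemma lipschitz_on_balls_scaleR:
  "lipschitz_on_balls F \<Longrightarrow> lipschitz_on_balls (\<lambda>u. a *\<^sub>R F u)"
  unfolding lipschitz_on_balls_def by (blast intro: lipschitz_on_cmult)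

lemma lipschitz_on_balls_shift: "lipschitz_on_balls (shift k)"
  unfolding lipschitz_on_balls_def
  by (auto intro!: exI[of _ 1] lipschitz_onI simp: dist_norm norm_shift simp flip: shift_diff)

lemma lipschitz_on_balls_pmul:
  assumes "lipschitz_on_balls F" "lipschitz_on_balls G"
  shows "lipschitz_on_balls (\<lambda>u. pmul (F u) (G u))"
  unfolding lipschitz_on_balls_def
proof
  fix R
  obtain L where L: "L-lipschitz_on (cball 0 R) F" using assms(1) by (auto simp: lipschitz_on_balls_def)
  obtain M where M: "M-lipschitz_on (cball 0 R) G" using assms(2) by (auto simp: lipschitz_on_balls_def)
  define A where "A = norm (F 0) + L * R"
  define B where "B = norm (G 0) + M * R"
  have LM: "L \<ge> 0" "M \<ge> 0" using L M lipschitz_on_nonneg by auto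
  show "\<exists>K. K-lipschitz_on (cball 0 R) (\<lambda>u. pmul (F u) (G u))"
  \<comment> \<open>A negative radius gives the empty ball; otherwise the centre 0 belongs to it and
    \<open>A\<close>, \<open>B\<close> are nonnegative bounds on both factors.\<close>
  proof (cases "R \<ge> 0")
    case False
    then have "cball (0::'a) R = {}" by simp
    then show ?thesis by (auto intro: exI[of _ 0])
  next
    case True
    have A: "norm (F u) \<le> A" if "u \<in> cball 0 R" for u
    proof -
      have "norm (F u - F 0) \<le> L * norm (u - 0)" using that True by (intro lipschitz_on_normD[OF L]) auto
      also have "\<dots> \<le> L * R" using that LM by (intro mult_left_mono) auto
      finally show ?thesis using norm_triangle_sub[of "F u" "F 0"] by (simp add: A_def)
    qed
    have B: "norm (G u) \<le> B" if "u \<in> cball 0 R" for u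
    proof -
      have "norm (G u - G 0) \<le> M * norm (u - 0)" using that True by (intro lipschitz_on_normD[OF M]) auto
      also have "\<dots> \<le> M * R" using that LM by (intro mult_left_mono) auto
      finally show ?thesis using norm_triangle_sub[of "G u" "G 0"] by (simp add: B_def)
    qed
    have AB: "A \<ge> 0" "B \<ge> 0" using LM True by (auto simp: A_def B_def)
    have "(L * B + A * M)-lipschitz_on (cball 0 R) (\<lambda>u. pmul (F u) (G u))"
    proof (rule lipschitz_onI)
      fix u v :: 'a assume uv: "u \<in> cball 0 R" "v \<in> cball 0 R"
      have "norm (pmul (F u) (G u) - pmul (F v) (G v))
          \<le> norm (pmul (F u - F v) (G u)) + norm (pmul (F v) (G u - G v))"
        unfolding pmul_diff[of "F u" "G u"] by (rule norm_triangle_ineq)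
      also have "\<dots> \<le> norm (F u - F v) * norm (G u) + norm (F v) * norm (G u - G v)"
        by (intro add_mono norm_pmul_le)
      also have "\<dots> \<le> (L * norm (u - v)) * B + A * (M * norm (u - v))"
        using uv LM AB by (intro add_mono mult_mono lipschitz_on_normD[OF L] lipschitz_on_normD[OF M] A B) auto
      finally show "dist (pmul (F u) (G u)) (pmul (F v) (G v)) \<le> (L * B + A * M) * dist u v"
        by (simp add: dist_norm algebra_simps)
    qed (use LM AB in simp)
    then show ?thesis by blast
  qed
qed

lemma lipschitz_on_balls_lattice_field: "lipschitz_on_balls (lattice_field \<nu> \<alpha> \<beta> \<gamma> lam f)"
  unfolding lattice_field_eq[abs_def]
  by (intro lipschitz_on_balls_add lipschitz_on_balls_diff lipschitz_on_balls_scaleR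
      lipschitz_on_balls_pmul lipschitz_on_balls_shift lipschitz_on_balls_id lipschitz_on_balls_const)

section \<open>Summation by parts and the weighted energy inequality\<close>

lemma has_sum_inner_ell2: "((\<lambda>i. component u i * component v i) has_sum (u \<bullet> v)) UNIV"
  using has_sum_infsum[OF square_summable_prod[OF square_summable_component square_summable_component]]
  by (simp add: inner_ell2.rep_eq)

lemma has_sum_norm_ell2: "((\<lambda>i. (component u i)\<^sup>2) has_sum (norm u)\<^sup>2) UNIV"
  using has_sum_inner_ell2[of u u] unfolding power2_norm_eq_inner by (simp add: power2_eq_square)

lemma component_weight:
  assumes "0 \<le> \<theta> i" "\<theta> i \<le> 1"
  shows "component (weight \<theta> u) i = \<theta> i * component u i"
  using assms by (simp add: weight.rep_eq min_absorb2 max_absorb2)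

lemma norm_weight_le: "norm (weight \<theta> u) \<le> norm u"
  by (rule norm_ell2_le) (auto simp: weight.rep_eq abs_mult intro!: mult_left_le_one_le)

lemma bounded_linear_weight: "bounded_linear (weight \<theta>)"
proof (rule bounded_linear_intro)
  show "weight \<theta> (u + v) = weight \<theta> u + weight \<theta> v" for u v
    by transfer (simp add: algebra_simps)
  show "weight \<theta> (r *\<^sub>R u) = r *\<^sub>R weight \<theta> u" for r u
    by transfer (simp add: algebra_simps)
  show "norm (weight \<theta> u) \<le> norm u * 1" for u by (simp add: norm_weight_le)
qed

lemma weight_inner_commute: "weight \<theta> u \<bullet> v = u \<bullet> weight \<theta> v"
  by transfer (simp add: algebra_simps)

text \<open>Summation by parts moves the difference from \<open>a\<close> to the weight: the sum
  equals that of \<open>(\<theta> (i - k) - \<theta> i) * a i\<close>. Every shift difference thus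
  costs only the slope \<delta>.\<close>

lemma weighted_shift_sum_le:
  fixes a \<theta> :: "int \<Rightarrow> real"
  assumes a: "\<And>i. 0 \<le> a i" "(a has_sum A) UNIV"
    and \<theta>: "\<And>i. 0 \<le> \<theta> i" "\<And>i. \<theta> i \<le> 1" "\<And>i. \<bar>\<theta> (i - k) - \<theta> i\<bar> \<le> \<delta>"
  shows "\<exists>e\<le>\<delta> * A. ((\<lambda>i. \<theta> i * (a (i + k) - a i)) has_sum e) UNIV"
proof -
  have sum: "(\<lambda>i. \<theta> (i - j) * a i) summable_on UNIV" for j
    using has_sum_imp_summable[OF a(2)]
    by (rule summable_on_comparison_test) (auto simp: a \<theta> mult_left_le_one_le)
  then obtain x where x: "((\<lambda>i. \<theta> i * a i) has_sum x) UNIV"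
    using sum[of 0] by (auto simp: summable_on_def)
  obtain y where y: "((\<lambda>i. \<theta> (i - k) * a i) has_sum y) UNIV"
    using sum[of k] by (auto simp: summable_on_def)
  have "bij_betw (\<lambda>i. i + k) UNIV (UNIV :: int set)"
    by (rule bij_betw_byWitness[where f' = "\<lambda>i. i - k"]) auto
  from has_sum_reindex_bij_betw[OF this, of "\<lambda>i. \<theta> (i - k) * a i"] y
  have "((\<lambda>i. \<theta> i * a (i + k)) has_sum y) UNIV" by simp
  from has_sum_add[OF this has_sum_cmult_right[OF x, of "- 1"]]
  have "((\<lambda>i. \<theta> i * (a (i + k) - a i)) has_sum (y - x)) UNIV" by (simp add: right_diff_distrib)
  moreover have "y - x \<le> \<delta> * A"
  proof (rule has_sum_mono[OF _ has_sum_cmult_right[OF a(2)]])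
    show "((\<lambda>i. \<theta> (i - k) * a i - \<theta> i * a i) has_sum (y - x)) UNIV"
      using has_sum_add[OF y has_sum_cmult_right[OF x, of "- 1"]] by simp
    fix i
    have "\<theta> (i - k) * a i - \<theta> i * a i = (\<theta> (i - k) - \<theta> i) * a i" by (simp add: left_diff_distrib)
    also have "\<dots> \<le> \<delta> * a i" using \<theta>(3)[of i] a(1) by (intro mult_right_mono) auto
    finally show "\<theta> (i - k) * a i - \<theta> i * a i \<le> \<delta> * a i" .
  qed
  ultimately show ?thesis by blast
qed

text \<open>The gap between the two sides is \<open>((x + y)\<^sup>2 + (x + z)\<^sup>2) / 2\<close>.
  Neighbours appear only through differences to \<open>x\<close>, the form required for summation by
  parts.\<close>

lemma diffusion_le:
  fixes x y z :: real
  shows "x * (- y + 2 * x - z) \<le> 4 * x\<^sup>2 + (y\<^sup>2 - x\<^sup>2) / 2 + (z\<^sup>2 - x\<^sup>2) / 2"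
proof -
  have "0 \<le> (x + y)\<^sup>2 + (x + z)\<^sup>2" by simp
  then show ?thesis by (simp add: power2_eq_square field_simps)
qed

lemma convection_le:
  fixes x y :: real
  shows "- (x\<^sup>2 * (y - x)) \<le> 2 * \<bar>x\<bar> ^ 3 + (\<bar>y\<bar> ^ 3 - \<bar>x\<bar> ^ 3) / 3"
proof -
  define a b where "a = \<bar>x\<bar>" and "b = \<bar>y\<bar>"
  have ab: "a \<ge> 0" "b \<ge> 0" by (auto simp: a_def b_def)
  \<comment> \<open>The product expands to \<open>2 * a ^ 3 - 3 * (a\<^sup>2 * b) + b ^ 3\<close>,
    which is Young's inequality with exponents 3/2 and 3.\<close>
  have "0 \<le> (a - b)\<^sup>2 * (2 * a + b)" using ab by simp
  then have young: "3 * (a\<^sup>2 * b) \<le> 2 * a ^ 3 + b ^ 3"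
    by (simp add: power2_eq_square power3_eq_cube algebra_simps)
  have "- (x\<^sup>2 * (y - x)) \<le> a\<^sup>2 * (b + a)"
    unfolding mult_minus_right[symmetric] a_def b_def power2_abs by (intro mult_left_mono) auto
  also have "\<dots> = a\<^sup>2 * b + a ^ 3" by (simp add: algebra_simps power2_eq_square power3_eq_cube)
  finally show ?thesis using young unfolding a_def b_def by (simp add: field_simps)
qed

text \<open>With \<open>x\<^sup>2\<close> factored out, a concave quadratic in the modulus
  \<open>a\<close> remains, maximal at \<open>a = m / (2 * \<beta>)\<close>; completing the square
  gives the maximum, the part of \<open>lambda_star\<close> beyond \<open>4 * \<nu>\<close>. The
  term \<open>2 * \<alpha> * \<bar>x\<bar> ^ 3\<close> is what \<open>convection_le\<close> leaves
  behind.\<close>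

lemma reaction_le:
  fixes x \<alpha> \<beta> \<gamma> :: real
  assumes "\<beta> > 0" "\<alpha> > 0" "\<gamma> > 0"
  shows "\<beta> * (x\<^sup>2 * ((1 - x) * (x - \<gamma>))) + 2 * \<alpha> * \<bar>x\<bar> ^ 3
    \<le> ((2 * \<alpha> + \<beta> + \<beta> * \<gamma>)\<^sup>2 / (4 * \<beta>) - \<beta> * \<gamma>) * x\<^sup>2"
proof -
  define m where "m = 2 * \<alpha> + \<beta> + \<beta> * \<gamma>"
  define a where "a = \<bar>x\<bar>"
  have a2: "x\<^sup>2 = a\<^sup>2" by (simp add: a_def)
  have "\<beta> * ((1 - x) * (x - \<gamma>)) = \<beta> * (1 + \<gamma>) * x - \<beta> * x\<^sup>2 - \<beta> * \<gamma>"
    by (simp add: algebra_simps power2_eq_square)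
  also have "\<dots> \<le> \<beta> * (1 + \<gamma>) * a - \<beta> * a\<^sup>2 - \<beta> * \<gamma>"
    using mult_left_mono[of x a "\<beta> * (1 + \<gamma>)"] assms by (simp add: a2) (simp add: a_def)
  also have "\<dots> = m * a - 2 * \<alpha> * a - \<beta> * a\<^sup>2 - \<beta> * \<gamma>" by (simp add: m_def algebra_simps)
  finally have 1: "\<beta> * ((1 - x) * (x - \<gamma>)) + 2 * \<alpha> * a \<le> m * a - \<beta> * a\<^sup>2 - \<beta> * \<gamma>" by simp
  have "0 \<le> (2 * \<beta> * a - m)\<^sup>2 / (4 * \<beta>)" using assms by simp
  also have "\<dots> = \<beta> * a\<^sup>2 - m * a + m\<^sup>2 / (4 * \<beta>)"
    using assms by (simp add: field_simps power2_eq_square)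
  finally have "\<beta> * ((1 - x) * (x - \<gamma>)) + 2 * \<alpha> * a \<le> m\<^sup>2 / (4 * \<beta>) - \<beta> * \<gamma>" using 1 by simp
  then have "a\<^sup>2 * (\<beta> * ((1 - x) * (x - \<gamma>)) + 2 * \<alpha> * a) \<le> a\<^sup>2 * (m\<^sup>2 / (4 * \<beta>) - \<beta> * \<gamma>)"
    by (intro mult_left_mono) auto
  then show ?thesis
    by (simp add: a2 m_def flip: a_def) (simp add: algebra_simps power2_eq_square power3_eq_cube)
qed

text \<open>All neighbour terms are now shift differences: they cancel in an unweighted sum and are
  of order \<delta> in a weighted one.\<close>

lemma lattice_field_component_le:
  assumes "\<alpha> > 0" "\<beta> > 0" "\<nu> > 0" "\<gamma> > 0"
  shows "component u i * component (lattice_field \<nu> \<alpha> \<beta> \<gamma> lam f u) i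
    \<le> - (lam - lambda_star \<nu> \<alpha> \<beta> \<gamma>) * (component u i)\<^sup>2 + component u i * component f i
      + \<nu> / 2 * ((component u (i - 1))\<^sup>2 - (component u i)\<^sup>2) + \<nu> / 2 * ((component u (i + 1))\<^sup>2 - (component u i)\<^sup>2)
      + \<alpha> / 3 * (\<bar>component u (i - 1)\<bar> ^ 3 - \<bar>component u i\<bar> ^ 3)"
proof -
  define x y z where "x = component u i" and "y = component u (i - 1)" and "z = component u (i + 1)"
  have "component u i * component (lattice_field \<nu> \<alpha> \<beta> \<gamma> lam f u) i
      = \<nu> * (x * (- y + 2 * x - z)) + \<alpha> * (- (x\<^sup>2 * (y - x))) + \<beta> * (x\<^sup>2 * ((1 - x) * (x - \<gamma>)))
        - lam * x\<^sup>2 + x * component f i"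
    by (simp add: lattice_field.rep_eq lattice_Lambda_def lattice_Dminus_def x_def y_def z_def
        algebra_simps power2_eq_square)
  also have "\<dots> \<le> \<nu> * (4 * x\<^sup>2 + (y\<^sup>2 - x\<^sup>2) / 2 + (z\<^sup>2 - x\<^sup>2) / 2)
      + \<alpha> * (2 * \<bar>x\<bar> ^ 3 + (\<bar>y\<bar> ^ 3 - \<bar>x\<bar> ^ 3) / 3)
      + (((2 * \<alpha> + \<beta> + \<beta> * \<gamma>)\<^sup>2 / (4 * \<beta>) - \<beta> * \<gamma>) * x\<^sup>2 - 2 * \<alpha> * \<bar>x\<bar> ^ 3) - lam * x\<^sup>2 + x * component f i"
    using mult_left_mono[OF diffusion_le[of x y z] less_imp_le[OF assms(3)]]
      mult_left_mono[OF convection_le[of x y] less_imp_le[OF assms(1)]]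
      reaction_le[OF assms(2,1,4), of x]
    by (intro add_right_mono diff_right_mono add_mono) (assumption | simp)+
  also have "\<dots> = - (lam - lambda_star \<nu> \<alpha> \<beta> \<gamma>) * x\<^sup>2 + x * component f i
      + \<nu> / 2 * (y\<^sup>2 - x\<^sup>2) + \<nu> / 2 * (z\<^sup>2 - x\<^sup>2) + \<alpha> / 3 * (\<bar>y\<bar> ^ 3 - \<bar>x\<bar> ^ 3)"
    unfolding lambda_star_def by (simp add: algebra_simps add_divide_distrib diff_divide_distrib)
  finally show ?thesis by (simp add: x_def y_def z_def)
qed

lemma has_sum_cube_ell2: "\<exists>B\<le>norm u ^ 3. ((\<lambda>i. \<bar>component u i\<bar> ^ 3) has_sum B) UNIV"
proof -
  have *: "((\<lambda>i. norm u * (component u i)\<^sup>2) has_sum (norm u * (norm u)\<^sup>2)) UNIV"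
    by (rule has_sum_cmult_right[OF has_sum_norm_ell2])
  have le: "\<bar>component u i\<bar> ^ 3 \<le> norm u * (component u i)\<^sup>2" for i
    using mult_right_mono[OF abs_component_le_norm[of u i], of "(component u i)\<^sup>2"]
    by (simp add: power2_eq_square power3_eq_cube flip: abs_mult)
  have "(\<lambda>i. \<bar>component u i\<bar> ^ 3) summable_on UNIV"
    using has_sum_imp_summable[OF *] le by (rule summable_on_comparison_test) simp
  then obtain B where B: "((\<lambda>i. \<bar>component u i\<bar> ^ 3) has_sum B) UNIV" by (auto simp: summable_on_def)
  from has_sum_mono[OF this * le] have "B \<le> norm u ^ 3" by (simp add: power3_eq_cube power2_eq_square)
  with B show ?thesis by blast
qed

lemma weighted_energy_le:
  assumes "\<alpha> > 0" "\<beta> > 0" "\<nu> > 0" "\<gamma> > 0"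
    and \<theta>: "\<And>i. 0 \<le> \<theta> i" "\<And>i. \<theta> i \<le> 1" "\<And>i. \<bar>\<theta> (i + 1) - \<theta> i\<bar> \<le> \<delta>"
  shows "weight \<theta> u \<bullet> lattice_field \<nu> \<alpha> \<beta> \<gamma> lam f u
    \<le> - (lam - lambda_star \<nu> \<alpha> \<beta> \<gamma>) * (weight \<theta> u \<bullet> u) + weight \<theta> u \<bullet> f
      + \<delta> * (\<nu> * (norm u)\<^sup>2 + \<alpha> / 3 * norm u ^ 3)"
proof -
  let ?u = "component u" and ?w = "component (weight \<theta> u)"
  have \<theta>': "\<bar>\<theta> (i - 1) - \<theta> i\<bar> \<le> \<delta>" "\<bar>\<theta> (i - - 1) - \<theta> i\<bar> \<le> \<delta>" for i
    using \<theta>(3)[of "i - 1"] \<theta>(3)[of i] by (auto simp: abs_minus_commute)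
  have \<delta>: "\<delta> \<ge> 0" using \<theta>(3)[of 0] by linarith
  have w: "?w i = \<theta> i * ?u i" for i by (simp add: component_weight \<theta>)
  obtain B where B: "B \<le> norm u ^ 3" "((\<lambda>i. \<bar>?u i\<bar> ^ 3) has_sum B) UNIV"
    using has_sum_cube_ell2 by blast
  obtain e1 where e1: "e1 \<le> \<delta> * (norm u)\<^sup>2" "((\<lambda>i. \<theta> i * ((?u (i + - 1))\<^sup>2 - (?u i)\<^sup>2)) has_sum e1) UNIV"
    using weighted_shift_sum_le[where a = "\<lambda>i. (?u i)\<^sup>2" and \<theta> = \<theta> and k = "- 1", OF _ has_sum_norm_ell2 \<theta>(1,2) \<theta>'(2)] by auto
  obtain e2 where e2: "e2 \<le> \<delta> * (norm u)\<^sup>2" "((\<lambda>i. \<theta> i * ((?u (i + 1))\<^sup>2 - (?u i)\<^sup>2)) has_sum e2) UNIV"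
    using weighted_shift_sum_le[where a = "\<lambda>i. (?u i)\<^sup>2" and \<theta> = \<theta> and k = 1, OF _ has_sum_norm_ell2 \<theta>(1,2) \<theta>'(1)] by auto
  obtain e3 where e3: "e3 \<le> \<delta> * B" "((\<lambda>i. \<theta> i * (\<bar>?u (i + - 1)\<bar> ^ 3 - \<bar>?u i\<bar> ^ 3)) has_sum e3) UNIV"
    using weighted_shift_sum_le[where a = "\<lambda>i. \<bar>?u i\<bar> ^ 3" and \<theta> = \<theta> and k = "- 1", OF _ B(2) \<theta>(1,2) \<theta>'(2)] by auto
  let ?\<kappa> = "lam - lambda_star \<nu> \<alpha> \<beta> \<gamma>"
  have "weight \<theta> u \<bullet> lattice_field \<nu> \<alpha> \<beta> \<gamma> lam f u
      \<le> - ?\<kappa> * (weight \<theta> u \<bullet> u) + weight \<theta> u \<bullet> f + \<nu> / 2 * e1 + \<nu> / 2 * e2 + \<alpha> / 3 * e3"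
  proof (rule has_sum_mono[OF has_sum_inner_ell2])
    show "((\<lambda>i. - ?\<kappa> * (?w i * ?u i) + ?w i * component f i
        + \<nu> / 2 * (\<theta> i * ((?u (i + - 1))\<^sup>2 - (?u i)\<^sup>2)) + \<nu> / 2 * (\<theta> i * ((?u (i + 1))\<^sup>2 - (?u i)\<^sup>2))
        + \<alpha> / 3 * (\<theta> i * (\<bar>?u (i + - 1)\<bar> ^ 3 - \<bar>?u i\<bar> ^ 3))) has_sum
        (- ?\<kappa> * (weight \<theta> u \<bullet> u) + weight \<theta> u \<bullet> f + \<nu> / 2 * e1 + \<nu> / 2 * e2 + \<alpha> / 3 * e3)) UNIV"
      by (intro has_sum_add has_sum_cmult_right has_sum_inner_ell2 e1 e2 e3)
    fix i
    from mult_left_mono[OF lattice_field_component_le[OF assms(1-4), of u i lam f] \<theta>(1)[of i]]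
    show "?w i * component (lattice_field \<nu> \<alpha> \<beta> \<gamma> lam f u) i
      \<le> - ?\<kappa> * (?w i * ?u i) + ?w i * component f i
        + \<nu> / 2 * (\<theta> i * ((?u (i + - 1))\<^sup>2 - (?u i)\<^sup>2)) + \<nu> / 2 * (\<theta> i * ((?u (i + 1))\<^sup>2 - (?u i)\<^sup>2))
        + \<alpha> / 3 * (\<theta> i * (\<bar>?u (i + - 1)\<bar> ^ 3 - \<bar>?u i\<bar> ^ 3))"
      unfolding w by (simp add: algebra_simps power2_eq_square)
  qed
  also have "\<dots> \<le> - ?\<kappa> * (weight \<theta> u \<bullet> u) + weight \<theta> u \<bullet> f
      + \<nu> / 2 * (\<delta> * (norm u)\<^sup>2) + \<nu> / 2 * (\<delta> * (norm u)\<^sup>2) + \<alpha> / 3 * (\<delta> * norm u ^ 3)"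
    using e1(1) e2(1) order_trans[OF e3(1) mult_left_mono[OF B(1) \<delta>]] assms(1,3)
    by (intro add_mono mult_left_mono order_refl) auto
  also have "\<dots> = - ?\<kappa> * (weight \<theta> u \<bullet> u) + weight \<theta> u \<bullet> f
      + \<delta> * (\<nu> * (norm u)\<^sup>2 + \<alpha> / 3 * norm u ^ 3)"
    by (simp add: algebra_simps)
  finally show ?thesis .
qed

lemma lattice_field_dissipative:
  assumes "\<alpha> > 0" "\<beta> > 0" "\<nu> > 0" "\<gamma> > 0"
  shows "u \<bullet> lattice_field \<nu> \<alpha> \<beta> \<gamma> lam f u
    \<le> - (lam - lambda_star \<nu> \<alpha> \<beta> \<gamma>) * (norm u)\<^sup>2 + norm f * norm u"
proof -
  \<comment> \<open>The constant cutoff has slope 0, so the weighted estimate has no error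
    term.\<close>
  have "weight (\<lambda>i. 1) u = u" by transfer simp
  with weighted_energy_le[OF assms, of "\<lambda>i. 1" 0 u lam f] show ?thesis
    using norm_cauchy_schwarz[of u f] by (simp add: power2_norm_eq_inner mult.commute)
qed

section \<open>From small tails to convergent subsequences\<close>

lemma finite_component_approx:
  assumes "e > 0"
  shows "\<exists>S. finite S \<and> (norm u)\<^sup>2 \<le> (\<Sum>i\<in>S. (component u i)\<^sup>2) + e"
proof -
  from has_sum_finite_approximation[OF has_sum_norm_ell2 assms, of u]
  obtain S where "finite S" "dist (\<Sum>i\<in>S. (component u i)\<^sup>2) ((norm u)\<^sup>2) \<le> e" by blast
  then show ?thesis by (intro exI[of _ S]) (auto simp: dist_real_def)
qed

lemma has_sum_restrict: "finite S \<Longrightarrow> ((\<lambda>i. if i \<in> S then g i else 0) has_sum (\<Sum>i\<in>S. g i)) UNIV"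
  for g :: "'i \<Rightarrow> real"
  by (rule has_sum_finite_neutralI) auto

text \<open>Applied to the forcing: a cutoff that vanishes where \<open>f\<close> is concentrated
  leaves only a small remainder of \<open>f\<close>.\<close>

lemma norm_weight_vanishing_le:
  assumes "finite S" "\<And>i. i \<in> S \<Longrightarrow> \<theta> i \<le> 0"
  shows "(norm (weight \<theta> u))\<^sup>2 + (\<Sum>i\<in>S. (component u i)\<^sup>2) \<le> (norm u)\<^sup>2"
proof (rule has_sum_mono[OF has_sum_add[OF has_sum_norm_ell2 has_sum_restrict[OF assms(1)]] has_sum_norm_ell2])
  show "(component (weight \<theta> u) i)\<^sup>2 + (if i \<in> S then (component u i)\<^sup>2 else 0) \<le> (component u i)\<^sup>2" for i
    using assms(2)[of i]
    by (auto simp: weight.rep_eq power_mult_distrib power_le_one mult_left_le_one_le max_absorb1)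
qed

lemma norm_le_weight:
  assumes "finite S" "\<And>i. i \<notin> S \<Longrightarrow> \<theta> i \<ge> 1"
  shows "(norm u)\<^sup>2 \<le> (\<Sum>i\<in>S. (component u i)\<^sup>2) + weight \<theta> u \<bullet> u"
proof (rule has_sum_mono[OF has_sum_norm_ell2 has_sum_add[OF has_sum_restrict[OF assms(1)] has_sum_inner_ell2]])
  show "(component u i)\<^sup>2 \<le> (if i \<in> S then (component u i)\<^sup>2 else 0) + component (weight \<theta> u) i * component u i" for i
    using assms(2)[of i] by (auto simp: weight.rep_eq power2_eq_square min_absorb1 mult.assoc)
qed

text \<open>Tychonoff compactness of a product of intervals gives a componentwise limit; uniform
  tails upgrade componentwise to norm convergence.\<close>

lemma convergent_subsequence_if_uniform_tails:
  fixes x :: "nat \<Rightarrow> ell2"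
  assumes bounded: "\<And>n. norm (x n) \<le> R"
    and tails: "\<And>e. e > 0 \<Longrightarrow> \<exists>S N. finite S \<and> (\<forall>n\<ge>N. (norm (x n))\<^sup>2 \<le> (\<Sum>i\<in>S. (component (x n) i)\<^sup>2) + e)"
  shows "\<exists>l r. strict_mono (r :: nat \<Rightarrow> nat) \<and> (\<lambda>n. x (r n)) \<longlonglongrightarrow> l"
proof -
  let ?K = "Pi\<^sub>E UNIV (\<lambda>_. {-R..R}) :: (int \<Rightarrow> real) set"
  have "compactin (product_topology (\<lambda>_. euclidean) UNIV) ?K"
    by (simp add: compactin_PiE compactin_euclidean_iff)
  then have "seq_compact ?K"
    by (simp add: euclidean_product_topology compactin_euclidean_iff compact_eq_seq_compact_metric)
  moreover have "\<forall>n. component (x n) \<in> ?K"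
    using order_trans[OF abs_component_le_norm bounded] by (auto simp: abs_le_iff minus_le_iff)
  ultimately obtain L r where r: "strict_mono (r :: nat \<Rightarrow> nat)" and lim: "((\<lambda>n. component (x n)) \<circ> r) \<longlonglongrightarrow> L"
    by (rule seq_compactE)
  have L: "(\<lambda>n. component (x (r n)) i) \<longlonglongrightarrow> L i" for i
    using continuous_on_tendsto_compose[OF continuous_on_product_coordinates lim, of i] by (simp add: o_def)
  have "Cauchy (\<lambda>n. x (r n))"
  proof (rule metric_CauchyI)
    fix e :: real assume e: "e > 0"
    \<comment> \<open>The final bound is \<open>8 * h\<close>: \<open>4 * h\<close> from the two
      tails and \<open>4 * h\<close> from the finitely many components in \<open>S\<close>.\<close>
    define h where "h = e\<^sup>2 / 16"
    have h: "h > 0" using e by (simp add: h_def)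
    obtain S N where S: "finite S" and N: "\<And>n. n \<ge> N \<Longrightarrow> (norm (x n))\<^sup>2 \<le> (\<Sum>i\<in>S. (component (x n) i)\<^sup>2) + h"
      using tails[OF h] by blast
    define s where "s n = (\<Sum>i\<in>S. (component (x (r n)) i - L i)\<^sup>2)" for n
    have "s \<longlonglongrightarrow> (\<Sum>i\<in>S. (L i - L i)\<^sup>2)" unfolding s_def by (intro tendsto_intros L)
    then have "\<forall>\<^sub>F n in sequentially. s n < h" using h by (intro order_tendstoD(2)) auto
    then obtain M where M: "\<And>n. n \<ge> M \<Longrightarrow> s n < h" by (auto simp: eventually_sequentially)
    have "dist (x (r n)) (x (r m)) < e" if nm: "n \<ge> max M N" "m \<ge> max M N" for n m
    proof -
      define p q where "p = x (r n)" and "q = x (r m)"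
      have ge: "r n \<ge> N" "r m \<ge> N" using nm seq_suble[OF r, of n] seq_suble[OF r, of m] by auto
      let ?T = "\<lambda>u. \<Sum>i\<in>S. (component u i)\<^sup>2"
      \<comment> \<open>The parallelogram law holds for the norm and for the sum over
        \<open>S\<close>. Subtracting, and using that the tail of \<open>p + q\<close> is
        nonnegative, bounds the tail of \<open>p - q\<close> by twice the tails of \<open>p\<close>
        and \<open>q\<close>.\<close>
      have "(norm (p - q))\<^sup>2 + (norm (p + q))\<^sup>2 = 2 * (norm p)\<^sup>2 + 2 * (norm q)\<^sup>2"
        by (simp add: power2_norm_eq_inner algebra_simps inner_commute)
      moreover have "?T (p - q) + ?T (p + q) = 2 * ?T p + 2 * ?T q"
        by (simp add: minus_ell2.rep_eq plus_ell2.rep_eq power2_eq_square algebra_simps sum.distrib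
            sum_distrib_left sum_subtractf)
      moreover have "?T (p + q) \<le> (norm (p + q))\<^sup>2" by (rule sum_component_le_norm[OF S])
      moreover have "(norm p)\<^sup>2 \<le> ?T p + h" "(norm q)\<^sup>2 \<le> ?T q + h"
        using N ge by (auto simp: p_def q_def)
      moreover have "?T (p - q) \<le> 2 * s n + 2 * s m"
        unfolding s_def sum_distrib_left sum.distrib[symmetric]
      proof (rule sum_mono)
        fix i
        have "0 \<le> ((component p i - L i) + (component q i - L i))\<^sup>2" by simp
        then show "(component (p - q) i)\<^sup>2 \<le> 2 * (component (x (r n)) i - L i)\<^sup>2 + 2 * (component (x (r m)) i - L i)\<^sup>2"
          unfolding p_def[symmetric] q_def[symmetric]
          by (simp add: minus_ell2.rep_eq power2_eq_square algebra_simps)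
      qed
      moreover have "s n < h" "s m < h" using M nm by auto
      ultimately have "(norm (p - q))\<^sup>2 < 8 * h" by linarith
      also have "\<dots> \<le> e\<^sup>2" by (simp add: h_def)
      finally have "norm (p - q) < e" by (rule power2_less_imp_less) (use e in simp)
      then show ?thesis by (simp add: dist_norm p_def q_def)
    qed
    then show "\<exists>M. \<forall>m\<ge>M. \<forall>n\<ge>M. dist (x (r m)) (x (r n)) < e"
      by (intro exI[of _ "max M N"] allI impI)
  qed
  then have "convergent (\<lambda>n. x (r n))" by (rule Cauchy_convergent)
  then show ?thesis using r by (auto simp: convergent_def)
qed

section \<open>Uniform tails of the lattice system\<close>

lemma has_real_derivative_weight_inner:
  assumes "(u has_vector_derivative u') (at t within S)"
  shows "((\<lambda>t. weight \<theta> (u t) \<bullet> u t) has_real_derivative 2 * (weight \<theta> (u t) \<bullet> u')) (at t within S)"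
proof -
  have w: "((\<lambda>t. weight \<theta> (u t)) has_vector_derivative weight \<theta> u') (at t within S)"
    by (rule bounded_linear.has_vector_derivative[OF bounded_linear_weight assms])
  have "weight \<theta> u' \<bullet> u t = weight \<theta> (u t) \<bullet> u'"
    by (metis weight_inner_commute inner_commute)
  with w assms show ?thesis
    unfolding has_field_derivative_def has_vector_derivative_def
    by (auto intro!: derivative_eq_intros simp: fun_eq_iff)
qed

text \<open>Position and slope are independent parameters: \<open>K\<close> is adapted to the
  forcing, \<delta> to the size of the solutions. For positive \<delta> the rise takes length
  \<open>1 / \<delta>\<close>.\<close>

definition ramp :: "real \<Rightarrow> nat \<Rightarrow> int \<Rightarrow> real" where
  "ramp \<delta> K i = max 0 (min 1 (\<delta> * (real_of_int \<bar>i\<bar> - real K)))"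

lemma ramp_bounds: "0 \<le> ramp \<delta> K i" "ramp \<delta> K i \<le> 1"
  by (auto simp: ramp_def)

lemma ramp_slope:
  assumes "\<delta> \<ge> 0"
  shows "\<bar>ramp \<delta> K (i + 1) - ramp \<delta> K i\<bar> \<le> \<delta>"
proof -
  have "\<bar>ramp \<delta> K (i + 1) - ramp \<delta> K i\<bar>
      \<le> \<bar>\<delta> * (real_of_int \<bar>i + 1\<bar> - real K) - \<delta> * (real_of_int \<bar>i\<bar> - real K)\<bar>"
    unfolding ramp_def by linarith
  also have "\<dots> = \<delta> * abs (real_of_int \<bar>i + 1\<bar> - real_of_int \<bar>i\<bar>)"
    using assms by (simp add: abs_mult flip: right_diff_distrib)
  also have "\<dots> \<le> \<delta> * 1" using assms by (intro mult_left_mono) auto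
  finally show ?thesis by simp
qed

lemma ramp_eq_0:
  assumes "\<delta> \<ge> 0" "\<bar>i\<bar> \<le> int K"
  shows "ramp \<delta> K i = 0"
proof -
  have "\<delta> * (real_of_int \<bar>i\<bar> - real K) \<le> 0" using assms by (intro mult_nonneg_nonpos) linarith+
  then show ?thesis by (simp add: ramp_def)
qed

lemma ramp_eq_1:
  assumes "\<delta> > 0" "real_of_int \<bar>i\<bar> \<ge> real K + 1 / \<delta>"
  shows "ramp \<delta> K i = 1"
proof -
  have "1 = \<delta> * (1 / \<delta>)" using assms by simp
  also have "\<dots> \<le> \<delta> * (real_of_int \<bar>i\<bar> - real K)" using assms by (intro mult_left_mono) auto
  finally show ?thesis by (simp add: ramp_def)
qed

locale lattice_system =
  fixes \<nu> \<alpha> \<beta> \<gamma> lam :: real and f :: ell2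
  assumes \<alpha>: "\<alpha> > 0" and \<beta>: "\<beta> > 0" and \<nu>: "\<nu> > 0" and \<gamma>: "\<gamma> > 0"
    and lam: "lam > lambda_star \<nu> \<alpha> \<beta> \<gamma>"
begin

abbreviation "F \<equiv> lattice_field \<nu> \<alpha> \<beta> \<gamma> lam f"
abbreviation "\<kappa> \<equiv> lam - lambda_star \<nu> \<alpha> \<beta> \<gamma>"

sublocale dissipative_field F \<kappa> "norm f"
  using lipschitz_on_balls_lattice_field lattice_field_dissipative \<alpha> \<beta> \<nu> \<gamma> lam
  by unfold_locales auto

text \<open>Forcing and cutoff slope each contribute at most \<open>h\<close>, so the weighted
  energy obeys a linear inequality with rate \<open>2 * \<kappa>\<close> and source
  \<open>4 * h\<close>, whose equilibrium is \<open>2 * h / \<kappa>\<close>.\<close>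

lemma weighted_energy_decay:
  assumes \<theta>: "\<And>i. 0 \<le> \<theta> i" "\<And>i. \<theta> i \<le> 1" "\<And>i. \<bar>\<theta> (i + 1) - \<theta> i\<bar> \<le> \<delta>"
    and small: "norm (weight \<theta> f) * R \<le> h" "\<delta> * (\<nu> * R\<^sup>2 + \<alpha> / 3 * R ^ 3) \<le> h"
    and u: "solves_ivp F u0 u" and R: "\<And>s. s \<ge> 0 \<Longrightarrow> norm (u s) \<le> R" and t: "t \<ge> 0"
  shows "weight \<theta> (u t) \<bullet> u t \<le> exp (- (2 * \<kappa>) * t) * R\<^sup>2 + 2 * h / \<kappa>"
proof -
  have R0: "R \<ge> 0" using R[of 0] norm_ge_zero[of "u 0"] by linarith
  have \<delta>: "\<delta> \<ge> 0" using \<theta>(3)[of 0] by linarith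
  have "0 \<le> \<delta> * (\<nu> * R\<^sup>2 + \<alpha> / 3 * R ^ 3)"
    using \<delta> R0 \<nu> \<alpha> by (intro mult_nonneg_nonneg add_nonneg_nonneg) auto
  then have h: "h \<ge> 0" using small(2) by linarith
  have "weight \<theta> (u t) \<bullet> u t \<le> exp (- (2 * \<kappa>) * t) * (weight \<theta> (u 0) \<bullet> u 0 + (4 * h) / (- (2 * \<kappa>)))
      - (4 * h) / (- (2 * \<kappa>))"
  proof (rule gronwall_halfline[OF has_real_derivative_weight_inner _ _ t])
    fix s :: real assume s: "s \<ge> 0"
    show "(u has_vector_derivative F (u s)) (at s within {0..})"
      using u s by (simp add: solves_ivp_def)
    have "weight \<theta> (u s) \<bullet> f = u s \<bullet> weight \<theta> f" by (rule weight_inner_commute)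
    also have "\<dots> \<le> norm (u s) * norm (weight \<theta> f)" by (rule norm_cauchy_schwarz)
    also have "\<dots> \<le> R * norm (weight \<theta> f)" using R[OF s] by (intro mult_right_mono) auto
    also have "\<dots> \<le> h" using small(1) by (simp add: mult.commute)
    finally have 1: "weight \<theta> (u s) \<bullet> f \<le> h" .
    have "\<delta> * (\<nu> * (norm (u s))\<^sup>2 + \<alpha> / 3 * norm (u s) ^ 3) \<le> \<delta> * (\<nu> * R\<^sup>2 + \<alpha> / 3 * R ^ 3)"
      using R[OF s] \<delta> \<nu> \<alpha> by (intro mult_left_mono add_mono power_mono) auto
    then have 2: "\<delta> * (\<nu> * (norm (u s))\<^sup>2 + \<alpha> / 3 * norm (u s) ^ 3) \<le> h" using small(2) by linarith
    have "weight \<theta> (u s) \<bullet> F (u s) \<le> - \<kappa> * (weight \<theta> (u s) \<bullet> u s) + weight \<theta> (u s) \<bullet> f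
      + \<delta> * (\<nu> * (norm (u s))\<^sup>2 + \<alpha> / 3 * norm (u s) ^ 3)"
      by (rule weighted_energy_le[where \<theta> = \<theta> and \<delta> = \<delta>, OF \<alpha> \<beta> \<nu> \<gamma> \<theta>])
    also have "\<dots> \<le> - \<kappa> * (weight \<theta> (u s) \<bullet> u s) + h + h" using 1 2 by (intro add_mono order_refl)
    finally have "2 * (weight \<theta> (u s) \<bullet> F (u s)) \<le> 2 * (- \<kappa> * (weight \<theta> (u s) \<bullet> u s) + h + h)"
      by (intro mult_left_mono) auto
    also have "\<dots> = - (2 * \<kappa>) * (weight \<theta> (u s) \<bullet> u s) + 4 * h" by (simp add: algebra_simps)
    finally show "2 * (weight \<theta> (u s) \<bullet> F (u s)) \<le> - (2 * \<kappa>) * (weight \<theta> (u s) \<bullet> u s) + 4 * h" .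
  qed (use lam in auto)
  also have "\<dots> = exp (- (2 * \<kappa>) * t) * (weight \<theta> (u 0) \<bullet> u 0 - 2 * h / \<kappa>) + 2 * h / \<kappa>"
  proof -
    have "4 * h / (- (2 * k)) = - (2 * h / k)" for k by simp
    then show ?thesis by (simp only: diff_minus_eq_add add_uminus_conv_diff)
  qed
  also have "\<dots> \<le> exp (- (2 * \<kappa>) * t) * R\<^sup>2 + 2 * h / \<kappa>"
  proof (intro add_right_mono mult_left_mono)
    have "weight \<theta> (u 0) \<bullet> u 0 \<le> norm (weight \<theta> (u 0)) * norm (u 0)" by (rule norm_cauchy_schwarz)
    also have "\<dots> \<le> R * R"
      using order_trans[OF norm_weight_le R] R R0 by (intro mult_mono) auto
    finally have "weight \<theta> (u 0) \<bullet> u 0 \<le> R\<^sup>2" by (simp add: power2_eq_square)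
    moreover have "2 * h / \<kappa> \<ge> 0" using h lam by simp
    ultimately show "weight \<theta> (u 0) \<bullet> u 0 - 2 * h / \<kappa> \<le> R\<^sup>2" by linarith
  qed simp
  finally show ?thesis .
qed

lemma uniform_tails:
  assumes e: "e > 0"
  shows "\<exists>S T. finite S \<and> (\<forall>u0 t. norm u0 \<le> r \<longrightarrow> T \<le> t \<longrightarrow>
    (norm (solution F t u0))\<^sup>2 \<le> (\<Sum>i\<in>S. (component (solution F t u0) i)\<^sup>2) + e)"
proof -
  define R where "R = max 0 r + norm f / \<kappa>"
  \<comment> \<open>This makes the equilibrium \<open>2 * h / \<kappa>\<close> equal to
    \<open>e / 2\<close>; the other half of \<open>e\<close> is reserved for the decaying initial
    energy and fixes \<open>T\<close>.\<close>
  define h where "h = \<kappa> * e / 4"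
  have \<kappa>: "\<kappa> > 0" using lam by simp
  have h: "h > 0" using e \<kappa> by (simp add: h_def)
  have h_eq: "2 * h / \<kappa> = e / 2" using \<kappa> unfolding h_def by (simp only: times_divide_eq_right) (simp add: divide_simps)
  have R: "R \<ge> 0" using \<kappa> by (auto simp: R_def)
  define D where "D = \<nu> * R\<^sup>2 + \<alpha> / 3 * R ^ 3"
  have D: "D \<ge> 0" using R \<nu> \<alpha> by (auto simp: D_def)
  define \<delta> where "\<delta> = h / (D + 1)"
  have \<delta>: "\<delta> > 0" using h D by (simp add: \<delta>_def)
  have \<delta>D: "\<delta> * D \<le> h" using h D by (simp add: \<delta>_def field_simps)
  obtain S0 where S0: "finite S0" "(norm f)\<^sup>2 \<le> (\<Sum>i\<in>S0. (component f i)\<^sup>2) + (h / (R + 1))\<^sup>2"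
    using finite_component_approx[of "(h / (R + 1))\<^sup>2" f] h R by auto
  obtain K where K: "\<And>i. i \<in> S0 \<Longrightarrow> \<bar>i\<bar> \<le> int K"
  proof -
    have "bdd_above (abs ` S0)" using S0(1) by simp
    then obtain k where "\<And>i. i \<in> S0 \<Longrightarrow> \<bar>i\<bar> \<le> k" by (auto simp: bdd_above_def)
    then show thesis by (intro that[of "nat k"]) force
  qed
  let ?\<theta> = "ramp \<delta> K"
  have "(norm (weight ?\<theta> f))\<^sup>2 + (\<Sum>i\<in>S0. (component f i)\<^sup>2) \<le> (norm f)\<^sup>2"
    using ramp_eq_0[OF less_imp_le[OF \<delta>] K] by (intro norm_weight_vanishing_le[OF S0(1)]) simp
  with S0(2) have "(norm (weight ?\<theta> f))\<^sup>2 \<le> (h / (R + 1))\<^sup>2" by linarith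
  then have "norm (weight ?\<theta> f) \<le> h / (R + 1)" by (rule power2_le_imp_le) (use h R in simp)
  then have "norm (weight ?\<theta> f) * R \<le> h / (R + 1) * R" using R by (rule mult_right_mono)
  also have "\<dots> \<le> h" using h R by (simp add: field_simps)
  finally have fR: "norm (weight ?\<theta> f) * R \<le> h" .
  \<comment> \<open>Beyond \<open>M\<close> the ramp has reached 1, so the weighted energy there is
    the full tail.\<close>
  define M where "M = \<lceil>real K + 1 / \<delta>\<rceil>"
  have off: "?\<theta> i \<ge> 1" if "i \<notin> {- M..M}" for i
  proof -
    have "M < \<bar>i\<bar>" using that by auto
    then have "real K + 1 / \<delta> \<le> real_of_int \<bar>i\<bar>" unfolding M_def by linarith
    then show ?thesis using ramp_eq_1[OF \<delta>] by simp
  qed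
  have "((\<lambda>t. exp (- (2 * \<kappa>) * t) * R\<^sup>2) \<longlongrightarrow> 0 * R\<^sup>2) at_top"
  proof (intro tendsto_mult tendsto_const filterlim_compose[OF exp_at_bot])
    show "filterlim (\<lambda>t. - (2 * \<kappa>) * t) at_bot at_top"
      using \<kappa> by (intro filterlim_tendsto_neg_mult_at_bot[OF tendsto_const _ filterlim_ident]) auto
  qed
  then have "\<forall>\<^sub>F t in at_top. exp (- (2 * \<kappa>) * t) * R\<^sup>2 < e / 2"
    using e by (intro order_tendstoD(2)) auto
  then obtain T where T: "\<And>t. t \<ge> T \<Longrightarrow> exp (- (2 * \<kappa>) * t) * R\<^sup>2 < e / 2"
    by (auto simp: eventually_at_top_linorder)
  have "(norm (solution F t u0))\<^sup>2 \<le> (\<Sum>i\<in>{- M..M}. (component (solution F t u0) i)\<^sup>2) + e"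
    if u0: "norm u0 \<le> r" and t: "t \<ge> max 0 T" for u0 t
  proof -
    have "norm (solution F s u0) \<le> R" if "s \<ge> 0" for s
      unfolding R_def using solves_ivp_norm_le[OF solves_ivp_solution that, of u0 "max 0 r"] u0 by simp
    then have "weight ?\<theta> (solution F t u0) \<bullet> solution F t u0 \<le> exp (- (2 * \<kappa>) * t) * R\<^sup>2 + 2 * h / \<kappa>"
      using t ramp_slope[OF less_imp_le[OF \<delta>]] \<delta>D
      by (intro weighted_energy_decay[OF ramp_bounds _ fR _ solves_ivp_solution]) (auto simp: D_def)
    also have "\<dots> \<le> e / 2 + e / 2"
      using T[of t] t h_eq by (intro add_mono) auto
    finally have "weight ?\<theta> (solution F t u0) \<bullet> solution F t u0 \<le> e" by simp
    then show ?thesis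
      using norm_le_weight[of "{- M..M}" ?\<theta> "solution F t u0", OF _ off] by simp
  qed
  then show ?thesis by (intro exI[of _ "{- M..M}"] exI[of _ "max 0 T"]) simp
qed

sublocale asymptotically_compact_field F \<kappa> "norm f"
proof
  fix s :: "nat \<Rightarrow> real" and x :: "nat \<Rightarrow> ell2"
  assume s: "\<And>n. s n \<ge> 0" "filterlim s at_top sequentially" and x: "\<And>n. norm (x n) \<le> 1 + norm f / \<kappa>"
  show "\<exists>l r. strict_mono (r :: nat \<Rightarrow> nat) \<and> (\<lambda>n. solution F (s (r n)) (x (r n))) \<longlonglongrightarrow> l"
  proof (rule convergent_subsequence_if_uniform_tails)
    show "norm (solution F (s n) (x n)) \<le> 1 + norm f / \<kappa> + norm f / \<kappa>" for n
      by (rule solves_ivp_norm_le[OF solves_ivp_solution s(1) x])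
    fix e :: real assume "e > 0"
    from uniform_tails[OF this, of "1 + norm f / \<kappa>"] obtain S T where S: "finite S"
      and T: "\<And>u0 t. norm u0 \<le> 1 + norm f / \<kappa> \<Longrightarrow> T \<le> t \<Longrightarrow>
        (norm (solution F t u0))\<^sup>2 \<le> (\<Sum>i\<in>S. (component (solution F t u0) i)\<^sup>2) + e"
      by blast
    have "\<forall>\<^sub>F n in sequentially. T \<le> s n" using s(2) by (simp add: filterlim_at_top)
    then obtain N where "\<And>n. n \<ge> N \<Longrightarrow> T \<le> s n" by (auto simp: eventually_sequentially)
    then show "\<exists>S N. finite S \<and> (\<forall>n\<ge>N. (norm (solution F (s n) (x n)))\<^sup>2
        \<le> (\<Sum>i\<in>S. (component (solution F (s n) (x n)) i)\<^sup>2) + e)"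
      using S T x by (intro exI[of _ S] exI[of _ N]) simp
  qed
qed

end

theorem theorem2p2:
  fixes \<nu> \<alpha> \<beta> \<gamma> lam :: real and f :: ell2
  assumes "\<alpha> > 0" and "\<beta> > 0" and "\<nu> > 0" and "lam > 0"
    and "0 < \<gamma>" and "\<gamma> < 1"
    and "lam > lambda_star \<nu> \<alpha> \<beta> \<gamma>"
  shows "(\<exists>!A. global_attractor (lattice_field \<nu> \<alpha> \<beta> \<gamma> lam f) A) \<and>
    (\<forall>A. global_attractor (lattice_field \<nu> \<alpha> \<beta> \<gamma> lam f) A \<longrightarrow>
      A = (\<Inter>T\<in>{0<..}. closure (\<Union>t\<in>{T..}.
             solution (lattice_field \<nu> \<alpha> \<beta> \<gamma> lam f) t `
               cball 0 (1 + norm f / (lam - lambda_star \<nu> \<alpha> \<beta> \<gamma>)))))"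
proof -
  interpret lattice_system \<nu> \<alpha> \<beta> \<gamma> lam f using assms by unfold_locales
  show ?thesis unfolding global_attractor_iff omega_limit_def by blast
qed

end
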